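(* Let $\mathcal S$ and $\mathcal T$ be two IFSs on Euclidean spaces satisfying the strong separation condition, where $\mathcal S$ has ratios $r_1,\dots,r_n$ and $\mathcal T$ has ratios $t_1,\dots,t_m$. Suppose that $E_{\mathcal S}$ and $E_{\mathcal T}$ are Lipschitz equivalent and $\dim_H E_{\mathcal S}=\dim_H E_{\mathcal T}=s$. Then $$\mathbb Z^+[r_1^s,\dots,r_n^s]=\mathbb Z^+[t_1^s,\dots,t_m^s].$$
   Context: Two metric spaces are Lipschitz equivalent if there is a bijection $f$ between them and $L\ge 1$ with $L^{-1}d_1(x,y)\le d_2(f(x),f(y))\le L\,d_1(x,y)$ for all $x,y$. An IFS is a finite family $\mathcal S=\{S_1,\dots,S_n\}$, $n\ge2$, of contracting similarities of a Euclidean space $\mathbb R^d$ ($d$ may depend on the IFS), where $S_i$ has ratio $r_i\in(0,1)$, i.e. $|S_i(x)-S_i(y)|=r_i|x-y|$. $E_{\mathcal S}$ is the unique nonempty compact set with $E_{\mathcal S}=\bigcup_i S_i(E_{\mathcal S})$. $\mathcal S$ satisfies the strong separation condition (SSC) if the sets $S_i(E_{\mathcal S})$ are pairwise disjoint. For positive numbers $a_1,\dots,a_n$, $\mathbb Z^+[a_1,\dots,a_n]$ denotes the smallest set of real numbers that contains $a_1,\dots,a_n$ and all positive integers and is closed under addition and multiplication. *)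

theory Defs
  imports "HOL-Analysis.Analysis"
begin

definition lipschitz_equivalent :: "'a::metric_space set \<Rightarrow> 'b::metric_space set \<Rightarrow> bool" where
  "lipschitz_equivalent A B \<longleftrightarrow>
     (\<exists>f L. L \<ge> 1 \<and> bij_betw f A B \<and>
       (\<forall>x\<in>A. \<forall>y\<in>A. inverse L * dist x y \<le> dist (f x) (f y) \<and> dist (f x) (f y) \<le> L * dist x y))"

(* |U|^s with the conventions of Hausdorff measure: the empty set contributes 0 and
   |U|^0 = 1 for nonempty U (whereas 0 powr 0 = 0 in HOL). *)
definition diameter_powr :: "real \<Rightarrow> 'a::metric_space set \<Rightarrow> ennreal" where
  "diameter_powr s U =
     (if U = {} then 0 else if s = 0 then 1 else ennreal (diameter U powr s))"

(* Boundedness of the covering sets is explicit because diameter is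
   unspecified on unbounded sets. Finite covers are padded with empty sets. *)
definition hausdorff_premeasure :: "real \<Rightarrow> real \<Rightarrow> 'a::metric_space set \<Rightarrow> ennreal" where
  "hausdorff_premeasure s \<delta> E =
     (INF U \<in> {U :: nat \<Rightarrow> 'a set. E \<subseteq> (\<Union>i. U i) \<and> (\<forall>i. bounded (U i) \<and> diameter (U i) \<le> \<delta>)}.
        (\<Sum>i. diameter_powr s (U i)))"

definition hausdorff_measure :: "real \<Rightarrow> 'a::metric_space set \<Rightarrow> ennreal" where
  "hausdorff_measure s E = (SUP \<delta> \<in> {0<..}. hausdorff_premeasure s \<delta> E)"

definition hausdorff_dim :: "'a::metric_space set \<Rightarrow> ereal" where
  "hausdorff_dim E = Inf (ereal ` {s. 0 \<le> s \<and> hausdorff_measure s E = 0})"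

definition similarity :: "real \<Rightarrow> ('a::metric_space \<Rightarrow> 'a) \<Rightarrow> bool" where
  "similarity r f \<longleftrightarrow> (\<forall>x y. dist (f x) (f y) = r * dist x y)"

definition is_ifs :: "nat \<Rightarrow> (nat \<Rightarrow> 'a::euclidean_space \<Rightarrow> 'a) \<Rightarrow> (nat \<Rightarrow> real) \<Rightarrow> bool" where
  "is_ifs n S r \<longleftrightarrow> 2 \<le> n \<and> (\<forall>i\<in>{1..n}. 0 < r i \<and> r i < 1 \<and> similarity (r i) (S i))"

(* By Hutchinson's theorem exactly one set E satisfies this when S is an IFS. *)
definition is_attractor :: "nat \<Rightarrow> (nat \<Rightarrow> 'a::euclidean_space \<Rightarrow> 'a) \<Rightarrow> 'a set \<Rightarrow> bool" where
  "is_attractor n S E \<longleftrightarrow> E \<noteq> {} \<and> compact E \<and> E = (\<Union>i\<in>{1..n}. S i ` E)"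

definition strong_separation :: "nat \<Rightarrow> (nat \<Rightarrow> 'a::euclidean_space \<Rightarrow> 'a) \<Rightarrow> 'a set \<Rightarrow> bool" where
  "strong_separation n S E \<longleftrightarrow> disjoint_family_on (\<lambda>i. S i ` E) {1..n}"

inductive_set pos_int_adjoin :: "real set \<Rightarrow> real set" for A :: "real set" where
  gen: "a \<in> A \<Longrightarrow> a \<in> pos_int_adjoin A"
| pos_int: "0 < k \<Longrightarrow> real k \<in> pos_int_adjoin A"
| add: "x \<in> pos_int_adjoin A \<Longrightarrow> y \<in> pos_int_adjoin A \<Longrightarrow> x + y \<in> pos_int_adjoin A"
| mult: "x \<in> pos_int_adjoin A \<Longrightarrow> y \<in> pos_int_adjoin A \<Longrightarrow> x * y \<in> pos_int_adjoin A"

end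

(* Counting cylinders with weight r_w^s (the Moran equation gives total mass 1) defines a finitely
   additive content on the clopen subsets of each attractor. For a bi-Lipschitz bijection f, the image
   of a cylinder is, up to scaling, one of finitely many unions of cylinders, so the density
   content(f(E_u)) / content(E_u) takes a child-to-parent ratio in a finite set. The density is bounded,
   hence constant below a cylinder E_u on which it is nearly maximal. Write f(E_u) as a disjoint union of
   cylinders F_w. The union of the F_{wj} has t_j^s times the content of f(E_u), and its preimage is a
   disjoint union of cylinders E_{uv}; hence t_j^s is the sum of the weights r_v^s. *)
theory Submission
  imports Defs
begin

text \<open>The content is the normalised \<open>s\<close>-dimensional Hausdorff measure on clopen
  sets, obtained from finite sums only. It needs the Moran equation, while \<open>s\<close> is given
  only as a Hausdorff dimension; hence the dimension of an attractor is computed in full, with the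
  content supplying the lower bound. The finiteness of the ratios comes from strong separation: an
  image f(E_u) keeps a distance from the rest of F that is comparable to its own diameter. So it
  sits in a cylinder of comparable size and is resolved a fixed number of levels below it, with
  constants independent of u. Boundedness of the density uses that both systems have the same
  exponent \<open>s\<close>.\<close>

declare One_nat_def [simp del]

text \<open>Downward closure of \<open>P i\<close> lets the minimum of finitely many witnesses serve
  every index. This supplies common separation distances and common saturation radii.\<close>

lemma finite_uniform_lower_bound:
  fixes P :: "'i \<Rightarrow> real \<Rightarrow> bool"
  assumes "finite I" and "\<And>i. i \<in> I \<Longrightarrow> \<exists>d>0. P i d"
    and "\<And>i d e. P i d \<Longrightarrow> 0 < e \<Longrightarrow> e \<le> d \<Longrightarrow> P i e"
  shows "\<exists>d>0. \<forall>i\<in>I. P i d"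
  using assms(1,2)
proof (induction I)
  case empty
  then show ?case by (auto intro: exI[of _ 1])
next
  case (insert i I)
  obtain d where d: "d > 0" "\<forall>i\<in>I. P i d" using insert by auto
  obtain e where e: "e > 0" "P i e" using insert.prems by auto
  have "0 < min d e" using d e by simp
  moreover have "\<forall>j\<in>insert i I. P j (min d e)"
    using d e assms(3)[OF _ \<open>0 < min d e\<close>] by auto
  ultimately show ?case by blast
qed

section \<open>Strongly separated systems: words, cylinders and separation scales\<close>

locale ssc_ifs =
  fixes n :: nat and S :: "nat \<Rightarrow> 'a::euclidean_space \<Rightarrow> 'a" and r :: "nat \<Rightarrow> real" and E :: "'a set"
  assumes ifs: "is_ifs n S r" and attractor: "is_attractor n S E"
    and separation: "strong_separation n S E"
begin

lemma n_ge_2: "2 \<le> n"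
  using ifs by (simp add: is_ifs_def)

lemma ratio_bounds: "i \<in> {1..n} \<Longrightarrow> 0 < r i \<and> r i < 1"
  using ifs by (auto simp: is_ifs_def)

lemma dist_map: "i \<in> {1..n} \<Longrightarrow> dist (S i x) (S i y) = r i * dist x y"
  using ifs by (auto simp: is_ifs_def similarity_def)

lemma inj_map: "i \<in> {1..n} \<Longrightarrow> inj (S i)"
proof (rule injI)
  fix x y assume i: "i \<in> {1..n}" and "S i x = S i y"
  then have "r i * dist x y = 0" using dist_map[OF i, of x y] by simp
  then show "x = y" using ratio_bounds[OF i] by auto
qed

lemma E_nonempty: "E \<noteq> {}" and compact_E: "compact E" and E_eq: "E = (\<Union>i\<in>{1..n}. S i ` E)"
  using attractor unfolding is_attractor_def by blast+

lemma map_disjoint: "i \<in> {1..n} \<Longrightarrow> j \<in> {1..n} \<Longrightarrow> i \<noteq> j \<Longrightarrow> S i ` E \<inter> S j ` E = {}"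
  using separation by (simp add: strong_separation_def disjoint_family_on_def)

lemma compact_map_image: "i \<in> {1..n} \<Longrightarrow> compact (S i ` E)"
proof (rule compact_continuous_image[OF _ compact_E])
  assume i: "i \<in> {1..n}"
  show "continuous_on E (S i)"
    using ratio_bounds[OF i] dist_map[OF i]
    by (intro lipschitz_on_continuous_on[of "r i"] lipschitz_onI) auto
qed

definition gap :: real where
  "gap = (SOME d. 0 < d \<and> (\<forall>i\<in>{1..n}. \<forall>j\<in>{1..n} - {i}. \<forall>x\<in>S i ` E. \<forall>y\<in>S j ` E. d \<le> dist x y))"

text \<open>Distinct first-level pieces are disjoint and compact, hence at positive distance, and
  there are finitely many pairs; \<open>gap\<close> is an arbitrary such bound.\<close>

lemma gap_props:
  "0 < gap \<and> (\<forall>i\<in>{1..n}. \<forall>j\<in>{1..n} - {i}. \<forall>x\<in>S i ` E. \<forall>y\<in>S j ` E. gap \<le> dist x y)"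
proof -
  have "\<exists>d>0. \<forall>i\<in>{1..n}. \<forall>j\<in>{1..n} - {i}. \<forall>x\<in>S i ` E. \<forall>y\<in>S j ` E. d \<le> dist x y"
  proof (rule finite_uniform_lower_bound)
    fix i assume i: "i \<in> {1..n}"
    show "\<exists>d>0. \<forall>j\<in>{1..n} - {i}. \<forall>x\<in>S i ` E. \<forall>y\<in>S j ` E. d \<le> dist x y"
    proof (rule finite_uniform_lower_bound)
      fix j assume j: "j \<in> {1..n} - {i}"
      show "\<exists>d>0. \<forall>x\<in>S i ` E. \<forall>y\<in>S j ` E. d \<le> dist x y"
        using separate_compact_closed[of "S i ` E" "S j ` E"] i j
        by (auto simp: compact_map_image compact_imp_closed map_disjoint)
    qed (auto intro: order_trans)
  qed (fastforce intro: order_trans)+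
  then show ?thesis unfolding gap_def by (rule someI_ex[of "\<lambda>d. 0 < d \<and> _ d"])
qed

lemma gap_pos: "0 < gap"
  using gap_props by blast

definition rmin :: real where "rmin = Min (r ` {1..n})"
definition rmax :: real where "rmax = Max (r ` {1..n})"

lemma rmin_le: "i \<in> {1..n} \<Longrightarrow> rmin \<le> r i"
  and le_rmax: "i \<in> {1..n} \<Longrightarrow> r i \<le> rmax"
  unfolding rmin_def rmax_def by auto

lemma rmin_pos: "0 < rmin" and rmax_pos: "0 < rmax" and rmax_less_1: "rmax < 1" and rmin_less_1: "rmin < 1"
proof -
  have ne: "{1..n} \<noteq> {}" using n_ge_2 by auto
  have "rmin \<in> r ` {1..n}" "rmax \<in> r ` {1..n}"
    unfolding rmin_def rmax_def using ne by (intro Min_in Max_in; simp)+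
  then show "0 < rmin" "0 < rmax" "rmax < 1" "rmin < 1" using ratio_bounds by auto
qed

text \<open>An upper bound that is positive by choice, so that it can be divided by.\<close>

definition diam_bound :: real where
  "diam_bound = (SOME D. 0 < D \<and> (\<forall>x\<in>E. \<forall>y\<in>E. dist x y \<le> D))"

lemma diam_bound_props: "0 < diam_bound \<and> (\<forall>x\<in>E. \<forall>y\<in>E. dist x y \<le> diam_bound)"
proof -
  obtain e where e: "\<forall>x\<in>E. \<forall>y\<in>E. dist x y \<le> e"
    using compact_imp_bounded[OF compact_E] unfolding bounded_two_points by blast
  have "0 < max e 1 \<and> (\<forall>x\<in>E. \<forall>y\<in>E. dist x y \<le> max e 1)" using e by (auto simp: max.coboundedI1)
  then show ?thesis unfolding diam_bound_def by (rule someI)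
qed

lemma diam_bound_pos: "0 < diam_bound"
  using diam_bound_props by blast

definition wds :: "nat list set" where "wds = lists {1..n}"

lemma wds_Nil [simp]: "[] \<in> wds"
  and wds_Cons [simp]: "i # w \<in> wds \<longleftrightarrow> i \<in> {1..n} \<and> w \<in> wds"
  and wds_append [simp]: "u @ v \<in> wds \<longleftrightarrow> u \<in> wds \<and> v \<in> wds"
  by (auto simp: wds_def)

definition words :: "nat \<Rightarrow> nat list set" where "words N = {w \<in> wds. length w = N}"

text \<open>The first letter is the outermost map, so appending letters at the end refines a
  cylinder and the children of \<open>w\<close> are \<open>w @ [i]\<close>.\<close>

definition word_map :: "nat list \<Rightarrow> 'a \<Rightarrow> 'a" where "word_map w = foldr (\<lambda>i g. S i \<circ> g) w id"

definition word_ratio :: "nat list \<Rightarrow> real" where "word_ratio w = prod_list (map r w)"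

definition cyl :: "nat list \<Rightarrow> 'a set" where "cyl w = word_map w ` E"

lemma finite_words [simp]: "finite (words N)"
proof -
  have "words N = {w. set w \<subseteq> {1..n} \<and> length w = N}"
    by (auto simp: words_def wds_def)
  then show ?thesis by (simp add: finite_lists_length_eq)
qed

lemma words_0: "words 0 = {[]}"
  by (auto simp: words_def)

lemma words_Suc: "words (Suc N) = (\<lambda>(w, i). w @ [i]) ` (words N \<times> {1..n})"
proof (intro set_eqI iffI)
  fix u assume "u \<in> words (Suc N)"
  then show "u \<in> (\<lambda>(w, i). w @ [i]) ` (words N \<times> {1..n})"
    by (cases u rule: rev_cases) (auto simp: words_def image_iff)
qed (auto simp: words_def)

lemma words_subset: "w \<in> words N \<Longrightarrow> w \<in> wds"
  by (simp add: words_def)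

lemma words_nonempty: "words N \<noteq> {}"
proof -
  have "replicate N 1 \<in> words N" using n_ge_2 by (auto simp: words_def wds_def in_lists_conv_set)
  then show ?thesis by blast
qed

lemma word_map_Nil [simp]: "word_map [] = id"
  and word_map_Cons: "word_map (i # w) = S i \<circ> word_map w"
  by (simp_all add: word_map_def)

lemma word_map_append: "word_map (u @ v) = word_map u \<circ> word_map v"
  by (induction u) (auto simp: word_map_Cons)

lemma word_ratio_Nil [simp]: "word_ratio [] = 1"
  and word_ratio_Cons: "word_ratio (i # w) = r i * word_ratio w"
  and word_ratio_append: "word_ratio (u @ v) = word_ratio u * word_ratio v"
  by (simp_all add: word_ratio_def)

lemma word_ratio_pos: "w \<in> wds \<Longrightarrow> 0 < word_ratio w"
  by (induction w) (use ratio_bounds in \<open>auto simp: word_ratio_Cons\<close>)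

lemma word_ratio_le: "w \<in> wds \<Longrightarrow> word_ratio w \<le> rmax ^ length w"
proof (induction w)
  case (Cons i w)
  then show ?case
    using le_rmax[of i] ratio_bounds[of i] word_ratio_pos[of w] rmax_pos
    by (auto simp: word_ratio_Cons intro!: mult_mono)
qed auto

lemma word_ratio_le_1: "w \<in> wds \<Longrightarrow> word_ratio w \<le> 1"
  using word_ratio_le[of w] rmax_pos rmax_less_1 power_le_one[of rmax "length w"] by linarith

lemma word_ratio_small:
  assumes "0 < e"
  obtains N where "\<And>w. w \<in> wds \<Longrightarrow> N \<le> length w \<Longrightarrow> word_ratio w < e"
proof -
  obtain N where N: "rmax ^ N < e" using real_arch_pow_inv[OF assms rmax_less_1] by blast
  show thesis
  proof
    fix w assume w: "w \<in> wds" "N \<le> length w"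
    have "word_ratio w \<le> rmax ^ N"
      using word_ratio_le[OF w(1)] power_decreasing[OF w(2), of rmax] rmax_pos rmax_less_1 by linarith
    then show "word_ratio w < e" using N by simp
  qed
qed

lemma dist_word_map: "w \<in> wds \<Longrightarrow> dist (word_map w x) (word_map w y) = word_ratio w * dist x y"
  by (induction w) (auto simp: word_map_Cons word_ratio_Cons dist_map)

lemma cyl_Nil [simp]: "cyl [] = E"
  by (simp add: cyl_def)

lemma cyl_Cons: "cyl (i # w) = S i ` cyl w"
  by (simp add: cyl_def word_map_Cons image_comp)

lemma cyl_append: "cyl (u @ v) = word_map u ` cyl v"
  by (simp add: cyl_def word_map_append image_comp)

lemma cyl_nonempty: "cyl w \<noteq> {}"
  using E_nonempty by (simp add: cyl_def)

lemma cyl_split: "cyl w = (\<Union>i\<in>{1..n}. cyl (w @ [i]))"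
proof -
  have "cyl w = word_map w ` (\<Union>i\<in>{1..n}. S i ` E)" using E_eq by (simp add: cyl_def)
  then show ?thesis by (simp add: cyl_append cyl_Cons image_UN)
qed

lemma cyl_subset: "w \<in> wds \<Longrightarrow> cyl w \<subseteq> E"
proof (induction w)
  case (Cons i w)
  then have "cyl (i # w) \<subseteq> S i ` E" by (auto simp: cyl_Cons)
  also have "\<dots> \<subseteq> E" using Cons.prems by (subst (2) E_eq) auto
  finally show ?case .
qed simp

lemma cyl_append_subset: "v \<in> wds \<Longrightarrow> cyl (u @ v) \<subseteq> cyl u"
  using cyl_subset[of v] by (auto simp: cyl_append cyl_def[of u])

lemma cyl_covered: "x \<in> cyl u \<Longrightarrow> \<exists>v\<in>words N. x \<in> cyl (u @ v)"
proof (induction N)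
  case (Suc N)
  then obtain v where v: "v \<in> words N" "x \<in> cyl (u @ v)" by blast
  then obtain i where "i \<in> {1..n}" "x \<in> cyl (u @ v @ [i])" using cyl_split[of "u @ v"] by auto
  then show ?case using v by (intro bexI[of _ "v @ [i]"]) (auto simp: words_def)
qed (simp add: words_0)

lemma E_covered: "x \<in> E \<Longrightarrow> \<exists>v\<in>words N. x \<in> cyl v"
  using cyl_covered[of x "[]" N] by simp

lemma cyl_disjoint:
  assumes "length u = length v" "u \<in> wds" "v \<in> wds" "u \<noteq> v"
  shows "cyl u \<inter> cyl v = {}"
  using assms
proof (induction u v rule: list_induct2)
  case (Cons i u j v)
  have sub: "cyl (i # u) \<subseteq> S i ` E" "cyl (j # v) \<subseteq> S j ` E"
    using Cons.prems cyl_subset[of u] cyl_subset[of v] by (auto simp: cyl_Cons)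
  show ?case
  proof (cases "i = j")
    case True
    then have "cyl u \<inter> cyl v = {}" using Cons by auto
    then show ?thesis using True inj_map[of i] Cons.prems by (auto simp: cyl_Cons inj_def)
  next
    case False
    then show ?thesis using sub map_disjoint[of i j] Cons.prems by fastforce
  qed
qed simp

lemma dist_cyl_le:
  assumes "w \<in> wds" "x \<in> cyl w" "y \<in> cyl w"
  shows "dist x y \<le> word_ratio w * diam_bound"
  using assms word_ratio_pos[OF assms(1)] diam_bound_props
  by (auto simp: cyl_def dist_word_map)

text \<open>Relative openness with a uniform radius: the rest of \<open>E\<close> keeps distance at
  least \<open>c\<close> from \<open>A\<close>. A bi-Lipschitz map distorts this radius by a bounded
  factor.\<close>

definition saturated :: "real \<Rightarrow> 'a set \<Rightarrow> bool" where
  "saturated c A \<longleftrightarrow> (\<forall>x\<in>A. \<forall>y\<in>E. dist x y < c \<longrightarrow> y \<in> A)"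

lemma saturated_mono: "saturated c A \<Longrightarrow> d \<le> c \<Longrightarrow> saturated d A"
  unfolding saturated_def by fastforce

text \<open>Two points of \<open>E\<close> closer than \<open>gap\<close> lie in the same
  first-level piece, and undoing \<open>S i\<close> divides their distance by \<open>r i\<close>; so
  each letter multiplies the radius by its ratio.\<close>

lemma cyl_saturated: "w \<in> wds \<Longrightarrow> saturated (gap * word_ratio w) (cyl w)"
proof (induction w)
  case Nil
  then show ?case by (simp add: saturated_def)
next
  case (Cons i w)
  have i: "i \<in> {1..n}" and w: "w \<in> wds" using Cons by auto
  have IH: "saturated (gap * word_ratio w) (cyl w)" using Cons by auto
  show ?case unfolding saturated_def
  proof (intro ballI impI)
    fix x y assume x: "x \<in> cyl (i # w)" and y: "y \<in> E"
      and d: "dist x y < gap * word_ratio (i # w)"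
    obtain j where j: "j \<in> {1..n}" "y \<in> S j ` E" using y E_eq by blast
    obtain x' where x': "x' \<in> cyl w" "x = S i x'" using x by (auto simp: cyl_Cons)
    obtain y' where y': "y' \<in> E" "y = S j y'" using j by auto
    have "x \<in> S i ` E" using x' cyl_subset[OF w] by auto
    have "gap * word_ratio (i # w) \<le> gap"
      using word_ratio_le_1[of "i # w"] gap_pos Cons.prems i w by (auto simp: mult_left_le)
    then have "dist x y < gap" using d by simp
    then have "\<not> gap \<le> dist x y" by simp
    then have "i = j" using gap_props i j \<open>x \<in> S i ` E\<close> by blast
    then have "r i * dist x' y' < r i * (gap * word_ratio w)"
      using d x' y' dist_map[OF i] by (simp add: word_ratio_Cons mult_ac)
    then have "dist x' y' < gap * word_ratio w" using ratio_bounds[OF i] by simp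
    then have "y' \<in> cyl w" using IH x' y' unfolding saturated_def by blast
    then show "y \<in> cyl (i # w)" using y' \<open>i = j\<close> by (auto simp: cyl_Cons)
  qed
qed

lemma saturated_UN: "(\<And>k. k \<in> K \<Longrightarrow> saturated c (A k)) \<Longrightarrow> saturated c (\<Union>k\<in>K. A k)"
  unfolding saturated_def by blast

text \<open>All distances inside the cylinder are below the saturation radius, so one common point
  draws the whole cylinder into \<open>A\<close>.\<close>

lemma cyl_subset_or_disjoint:
  assumes "saturated c A" "w \<in> wds" "word_ratio w * diam_bound < c"
  shows "cyl w \<subseteq> A \<or> cyl w \<inter> A = {}"
proof (rule disjCI)
  assume "cyl w \<inter> A \<noteq> {}"
  then obtain x where x: "x \<in> cyl w" "x \<in> A" by blast
  show "cyl w \<subseteq> A"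
  proof
    fix y assume y: "y \<in> cyl w"
    have "dist x y < c" using dist_cyl_le[OF assms(2) x(1) y] assms(3) by simp
    then show "y \<in> A" using assms(1) x y cyl_subset[OF assms(2)] unfolding saturated_def by blast
  qed
qed

text \<open>Descend from \<open>E\<close> along cylinders containing \<open>A\<close>. While the
  ratio exceeds the bound, the child through a chosen point of \<open>A\<close> has saturation
  radius above \<open>d\<close> and so contains \<open>A\<close> again; the factor
  \<open>rmin\<close> pays for this one step.\<close>

lemma enclosing_cylinder:
  assumes A: "A \<subseteq> E" "A \<noteq> {}" and d: "0 < d" "\<And>x y. x \<in> A \<Longrightarrow> y \<in> A \<Longrightarrow> dist x y \<le> d"
  obtains w where "w \<in> wds" "A \<subseteq> cyl w" "word_ratio w \<le> d / (gap * rmin)"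
proof -
  define b where "b = d / (gap * rmin)"
  have b: "0 < b" using d gap_pos rmin_pos by (simp add: b_def)
  \<comment> \<open>The alternative \<open>length w = N\<close> records a descent still under way;
    for large \<open>N\<close> it too forces the ratio below \<open>b\<close>.\<close>
  have ex: "\<exists>w\<in>wds. A \<subseteq> cyl w \<and> (word_ratio w \<le> b \<or> length w = N)" for N
  proof (induction N)
    case 0
    show ?case using A by (intro bexI[of _ "[]"]) auto
  next
    case (Suc N)
    then obtain w where w: "w \<in> wds" "A \<subseteq> cyl w" "word_ratio w \<le> b \<or> length w = N" by blast
    show ?case
    proof (cases "word_ratio w \<le> b")
      case False
      obtain x where x: "x \<in> A" using A by blast
      then obtain i where i: "i \<in> {1..n}" "x \<in> cyl (w @ [i])" using w cyl_split[of w] by blast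
      have wi: "w @ [i] \<in> wds" using w i by simp
      have "d = gap * (rmin * b)" using gap_pos rmin_pos by (simp add: b_def)
      also have "\<dots> < gap * (r i * word_ratio w)"
        using gap_pos rmin_pos rmin_le[OF i(1)] False b ratio_bounds[OF i(1)]
        by (intro mult_strict_left_mono mult_le_less_imp_less) auto
      finally have "d < gap * word_ratio (w @ [i])" by (simp add: word_ratio_append word_ratio_Cons mult_ac)
      then have "A \<subseteq> cyl (w @ [i])"
        using cyl_saturated[OF wi] x i(2) d(2)[OF x] A unfolding saturated_def by fastforce
      then show ?thesis using w False wi by (intro bexI[of _ "w @ [i]"]) auto
    qed (use w in blast)
  qed
  obtain N where N: "\<And>w. w \<in> wds \<Longrightarrow> N \<le> length w \<Longrightarrow> word_ratio w < b"
    using word_ratio_small[OF b] by blast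
  obtain w where "w \<in> wds" "A \<subseteq> cyl w" "word_ratio w \<le> b \<or> length w = N" using ex[of N] by blast
  then show thesis using that N[of w] by (force simp: b_def)
qed

end

section \<open>The Moran exponent and the finitely additive content\<close>

locale ssc_dim = ssc_ifs +
  fixes s :: real
  assumes moran: "(\<Sum>i\<in>{1..n}. r i powr s) = 1"
begin

text \<open>For \<open>s \<le> 0\<close> every summand of the Moran equation is at least 1, so the
  sum would be at least \<open>n\<close>.\<close>

lemma s_pos: "0 < s"
proof (rule ccontr)
  assume "\<not> 0 < s"
  have "real n = (\<Sum>i\<in>{1..n}. 1)" by simp
  also have "\<dots> \<le> (\<Sum>i\<in>{1..n}. r i powr s)"
  proof (rule sum_mono)
    fix i assume "i \<in> {1..n}"
    then show "1 \<le> r i powr s"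
      using ratio_bounds[of i] \<open>\<not> 0 < s\<close> powr_mono'[of s 0 "r i"] by simp
  qed
  finally show False using moran n_ge_2 by simp
qed

definition weight :: "nat list \<Rightarrow> real" where "weight w = word_ratio w powr s"

lemma weight_Nil [simp]: "weight [] = 1"
  by (simp add: weight_def)

lemma weight_pos: "w \<in> wds \<Longrightarrow> 0 < weight w"
  using word_ratio_pos[of w] by (simp add: weight_def)

lemma weight_append: "u \<in> wds \<Longrightarrow> v \<in> wds \<Longrightarrow> weight (u @ v) = weight u * weight v"
  using word_ratio_pos[of u] word_ratio_pos[of v]
  by (simp add: weight_def word_ratio_append powr_mult)

lemma weight_single: "weight [i] = r i powr s"
  by (simp add: weight_def word_ratio_Cons)

lemma sum_weight_children: "w \<in> wds \<Longrightarrow> (\<Sum>i\<in>{1..n}. weight (w @ [i])) = weight w"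
  using moran by (simp add: weight_append weight_single flip: sum_distrib_left)

lemma sum_words_Suc: "(\<Sum>w\<in>words (Suc N). g w) = (\<Sum>w\<in>words N. \<Sum>i\<in>{1..n}. g (w @ [i]))"
  for g :: "nat list \<Rightarrow> real"
  unfolding words_Suc
  by (subst sum.reindex) (auto simp: inj_on_def sum.cartesian_product intro!: sum.cong)

lemma sum_weight_words: "(\<Sum>w\<in>words N. weight w) = 1"
proof (induction N)
  case (Suc N)
  have "(\<Sum>w\<in>words (Suc N). weight w) = (\<Sum>w\<in>words N. weight w)"
    unfolding sum_words_Suc by (intro sum.cong) (auto simp: sum_weight_children words_subset)
  then show ?case using Suc by simp
qed (simp add: words_0)

definition level_content :: "nat \<Rightarrow> 'a set \<Rightarrow> real" where
  "level_content N A = (\<Sum>w\<in>words N. if cyl w \<subseteq> A then weight w else 0)"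

text \<open>On a set decided by the cylinders of some level the sequence is eventually constant, and
  the limit names that value without a choice of level.\<close>

definition content :: "'a set \<Rightarrow> real" where
  "content A = lim (\<lambda>N. level_content N A)"

definition resolved :: "nat \<Rightarrow> 'a set \<Rightarrow> bool" where
  "resolved N A \<longleftrightarrow> A \<subseteq> E \<and> (\<forall>w\<in>words N. cyl w \<subseteq> A \<or> cyl w \<inter> A = {})"

text \<open>By compactness of \<open>E\<close> these are its relatively clopen subsets.\<close>

definition simple :: "'a set \<Rightarrow> bool" where
  "simple A \<longleftrightarrow> A \<subseteq> E \<and> (\<exists>c>0. saturated c A)"

text \<open>The children of a cylinder inside or outside \<open>A\<close> lie on the same side, and
  by the Moran equation their weights add up to that of the parent.\<close>

lemma resolved_Suc:
  assumes "resolved N A"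
  shows "resolved (Suc N) A \<and> level_content (Suc N) A = level_content N A"
proof -
  have child: "cyl (w @ [i]) \<subseteq> cyl w" if "i \<in> {1..n}" for w i
    using that by (intro cyl_append_subset) auto
  have 1: "resolved (Suc N) A"
    using assms child unfolding resolved_def words_Suc by fastforce
  have iff: "cyl (w @ [i]) \<subseteq> A \<longleftrightarrow> cyl w \<subseteq> A" if "w \<in> words N" "i \<in> {1..n}" for w i
    using assms child[OF that(2), of w] that cyl_nonempty[of "w @ [i]"] unfolding resolved_def by blast
  have "level_content (Suc N) A = (\<Sum>w\<in>words N. \<Sum>i\<in>{1..n}. if cyl w \<subseteq> A then weight (w @ [i]) else 0)"
    unfolding level_content_def sum_words_Suc by (intro sum.cong refl) (use iff in auto)
  also have "\<dots> = level_content N A"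
    unfolding level_content_def by (intro sum.cong refl) (auto simp: sum_weight_children words_subset)
  finally show ?thesis using 1 by simp
qed

lemma resolved_mono:
  assumes "resolved N A" "N \<le> M"
  shows "resolved M A \<and> level_content M A = level_content N A"
  using assms(2) by (induction rule: dec_induct) (use assms(1) resolved_Suc in auto)

lemma content_eq: "resolved N A \<Longrightarrow> content A = level_content N A"
  unfolding content_def
  by (intro limI tendsto_eventually eventually_sequentiallyI[of N]) (use resolved_mono in blast)

lemma simple_resolved:
  assumes "simple A"
  obtains N where "\<And>M. N \<le> M \<Longrightarrow> resolved M A"
proof -
  obtain c where c: "c > 0" "saturated c A" and A: "A \<subseteq> E" using assms by (auto simp: simple_def)
  have "0 < c / diam_bound" using c diam_bound_pos by simp
  then obtain N where N: "\<And>w. w \<in> wds \<Longrightarrow> N \<le> length w \<Longrightarrow> word_ratio w < c / diam_bound"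
    using word_ratio_small by blast
  have "resolved M A" if "N \<le> M" for M
    unfolding resolved_def
  proof (intro conjI ballI)
    fix w assume "w \<in> words M"
    then have "w \<in> wds" "word_ratio w < c / diam_bound" using N[of w] that by (auto simp: words_def)
    then show "cyl w \<subseteq> A \<or> cyl w \<inter> A = {}"
      using cyl_subset_or_disjoint[OF c(2)] diam_bound_pos by (simp add: pos_less_divide_eq)
  qed (rule A)
  then show thesis using that by blast
qed

lemma simple_resolved2:
  assumes "simple A" "simple B"
  obtains N where "resolved N A" "resolved N B"
proof -
  obtain N1 where "\<And>M. N1 \<le> M \<Longrightarrow> resolved M A" using simple_resolved[OF assms(1)] by blast
  moreover obtain N2 where "\<And>M. N2 \<le> M \<Longrightarrow> resolved M B" using simple_resolved[OF assms(2)] by blast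
  ultimately show thesis using that[of "max N1 N2"] by simp
qed

lemma simple_cyl: "w \<in> wds \<Longrightarrow> simple (cyl w)"
  unfolding simple_def using cyl_saturated[of w] gap_pos word_ratio_pos[of w] cyl_subset[of w]
  by (auto intro!: exI[of _ "gap * word_ratio w"])

lemma simple_empty: "simple {}"
  unfolding simple_def saturated_def by (auto intro: exI[of _ 1])

lemma simple_UN:
  assumes "finite K" "\<And>k. k \<in> K \<Longrightarrow> simple (A k)"
  shows "simple (\<Union>k\<in>K. A k)"
proof -
  have "\<exists>c>0. \<forall>k\<in>K. saturated c (A k)"
    using assms by (intro finite_uniform_lower_bound) (auto simp: simple_def intro: saturated_mono)
  then show ?thesis using saturated_UN[of K _ A] assms(2) unfolding simple_def by blast
qed

text \<open>At a common resolving level every cylinder inside the union lies in exactly one of the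
  two sets.\<close>

lemma content_Un:
  assumes "simple A" "simple B" "A \<inter> B = {}"
  shows "content (A \<union> B) = content A + content B"
proof -
  obtain N where N: "resolved N A" "resolved N B" using simple_resolved2[OF assms(1,2)] by blast
  then have U: "resolved N (A \<union> B)" unfolding resolved_def by blast
  have "(if cyl w \<subseteq> A \<union> B then weight w else 0) =
    (if cyl w \<subseteq> A then weight w else 0) + (if cyl w \<subseteq> B then weight w else 0)" if "w \<in> words N" for w
  proof -
    have "cyl w \<subseteq> A \<or> cyl w \<inter> A = {}" "cyl w \<subseteq> B \<or> cyl w \<inter> B = {}"
      using N that unfolding resolved_def by auto
    moreover have "\<not> (cyl w \<subseteq> A \<and> cyl w \<subseteq> B)" using cyl_nonempty[of w] assms(3) by blast
    moreover have "\<not> cyl w \<subseteq> A \<union> B" if "cyl w \<inter> A = {}" "cyl w \<inter> B = {}"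
      using that cyl_nonempty[of w] by blast
    ultimately show ?thesis by auto
  qed
  then show ?thesis
    unfolding content_eq[OF U] content_eq[OF N(1)] content_eq[OF N(2)] level_content_def
    by (simp flip: sum.distrib)
qed

lemma content_mono:
  assumes "simple A" "simple B" "A \<subseteq> B"
  shows "content A \<le> content B"
proof -
  obtain N where N: "resolved N A" "resolved N B" using simple_resolved2[OF assms(1,2)] by blast
  show ?thesis
    unfolding content_eq[OF N(1)] content_eq[OF N(2)] level_content_def
    using assms(3) by (intro sum_mono) (auto intro: less_imp_le weight_pos words_subset)
qed

lemma content_empty: "content {} = 0"
  using content_Un[OF simple_empty simple_empty] by simp

lemma content_UN:
  assumes "finite K" "\<And>k. k \<in> K \<Longrightarrow> simple (A k)" "disjoint_family_on A K"
  shows "content (\<Union>k\<in>K. A k) = (\<Sum>k\<in>K. content (A k))"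
  using assms
proof (induction K)
  case empty
  then show ?case by (simp add: content_empty)
next
  case (insert k K)
  have "A k \<inter> (\<Union>j\<in>K. A j) = {}" using insert by (fastforce simp: disjoint_family_on_def)
  then have "content (A k \<union> (\<Union>j\<in>K. A j)) = content (A k) + content (\<Union>j\<in>K. A j)"
    using insert by (intro content_Un simple_UN) auto
  then show ?case using insert by (simp add: disjoint_family_on_def)
qed

lemma content_cyl:
  assumes "w \<in> wds"
  shows "content (cyl w) = weight w"
proof -
  define N where "N = length w"
  have w: "w \<in> words N" using assms by (simp add: words_def N_def)
  have dj: "cyl v \<inter> cyl w = {}" if "v \<in> words N" "v \<noteq> w" for v
    using that w by (intro cyl_disjoint) (auto simp: words_def)
  then have "resolved N (cyl w)" using cyl_subset[OF assms] unfolding resolved_def by blast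
  then have "content (cyl w) = (\<Sum>v\<in>words N. if cyl v \<subseteq> cyl w then weight v else 0)"
    by (simp add: content_eq level_content_def)
  also have "\<dots> = (\<Sum>v\<in>words N. if v = w then weight v else 0)"
    by (intro sum.cong refl) (use dj cyl_nonempty in force)
  also have "\<dots> = weight w" using w by simp
  finally show ?thesis .
qed

lemma content_pos:
  assumes "simple A" "A \<noteq> {}"
  shows "0 < content A"
proof -
  obtain N where N: "resolved N A" using simple_resolved2[OF assms(1) assms(1)] by blast
  obtain x where x: "x \<in> A" "x \<in> E" using assms by (auto simp: simple_def)
  then obtain w where w: "w \<in> words N" "x \<in> cyl w" using E_covered by blast
  then have "cyl w \<subseteq> A" using N x unfolding resolved_def by blast
  then have "content (cyl w) \<le> content A"
    using w assms by (intro content_mono simple_cyl) (auto simp: words_subset)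
  then show ?thesis using content_cyl[of w] weight_pos[of w] w by (simp add: words_subset)
qed

lemma subset_cyl_eq_UN:
  assumes "A \<subseteq> cyl u" "\<And>v. v \<in> words N \<Longrightarrow> cyl (u @ v) \<subseteq> A \<or> cyl (u @ v) \<inter> A = {}"
  shows "A = (\<Union>v\<in>{v\<in>words N. cyl (u @ v) \<subseteq> A}. cyl (u @ v))"
proof (intro subset_antisym subsetI)
  fix x assume x: "x \<in> A"
  then obtain v where "v \<in> words N" "x \<in> cyl (u @ v)" using assms(1) cyl_covered by blast
  then show "x \<in> (\<Union>v\<in>{v\<in>words N. cyl (u @ v) \<subseteq> A}. cyl (u @ v))" using assms(2)[of v] x by blast
qed blast

lemma disjoint_family_cyl:
  assumes "u \<in> wds" "K \<subseteq> words N"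
  shows "disjoint_family_on (\<lambda>v. cyl (u @ v)) K"
  unfolding disjoint_family_on_def
proof (intro ballI impI)
  fix v w assume "v \<in> K" "w \<in> K" "v \<noteq> w"
  then show "cyl (u @ v) \<inter> cyl (u @ w) = {}"
    using assms by (intro cyl_disjoint) (auto simp: words_def)
qed

text \<open>Self-similarity of the content: apart from the factor \<open>weight u\<close>, the value
  is a sum over a subset of the fixed finite set \<open>words N\<close>. For fixed \<open>N\<close>
  only finitely many such sums exist.\<close>

lemma content_subset_cyl:
  assumes A: "A \<subseteq> cyl u" and u: "u \<in> wds"
    and res: "\<And>v. v \<in> words N \<Longrightarrow> cyl (u @ v) \<subseteq> A \<or> cyl (u @ v) \<inter> A = {}"
  shows "content A = weight u * (\<Sum>v\<in>{v\<in>words N. cyl (u @ v) \<subseteq> A}. weight v)"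
proof -
  let ?K = "{v\<in>words N. cyl (u @ v) \<subseteq> A}"
  have "content A = content (\<Union>v\<in>?K. cyl (u @ v))"
    using subset_cyl_eq_UN[OF A res] by simp
  also have "\<dots> = (\<Sum>v\<in>?K. content (cyl (u @ v)))"
    by (rule content_UN) (use u in \<open>auto simp: words_subset intro: simple_cyl disjoint_family_cyl\<close>)
  also have "\<dots> = (\<Sum>v\<in>?K. weight u * weight v)"
    by (intro sum.cong refl) (use u in \<open>auto simp: content_cyl weight_append words_subset\<close>)
  finally show ?thesis by (simp add: sum_distrib_left)
qed

text \<open>Overlaps are allowed: at a level resolving all the given cylinders each word is counted
  in at least one of them, and the weights of that level total 1.\<close>

lemma content_cover:
  assumes "finite K" "\<And>k. k \<in> K \<Longrightarrow> W k \<in> wds" "E \<subseteq> (\<Union>k\<in>K. cyl (W k))"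
  shows "1 \<le> (\<Sum>k\<in>K. weight (W k))"
proof -
  have "\<exists>N. \<forall>k\<in>K. resolved N (cyl (W k))"
  proof -
    \<comment> \<open>Quantifying over all \<open>M\<close> beyond \<open>N\<close> lets the
      inductive step combine two levels by \<open>max\<close>.\<close>
    have "\<exists>N. \<forall>M\<ge>N. \<forall>k\<in>K. resolved M (cyl (W k))"
      using assms(1,2)
    proof (induction K)
      case (insert k K)
      then obtain N1 where "\<forall>M\<ge>N1. \<forall>k\<in>K. resolved M (cyl (W k))" by auto
      moreover obtain N2 where "\<And>M. N2 \<le> M \<Longrightarrow> resolved M (cyl (W k))"
        using simple_resolved simple_cyl insert.prems by blast
      ultimately show ?case by (intro exI[of _ "max N1 N2"]) auto
    qed auto
    then show ?thesis by blast
  qed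
  then obtain N where N: "\<And>k. k \<in> K \<Longrightarrow> resolved N (cyl (W k))" by blast
  have "1 = (\<Sum>v\<in>words N. weight v)" by (simp add: sum_weight_words)
  also have "\<dots> \<le> (\<Sum>v\<in>words N. \<Sum>k\<in>K. if cyl v \<subseteq> cyl (W k) then weight v else 0)"
  proof (rule sum_mono)
    fix v assume v: "v \<in> words N"
    obtain x where x: "x \<in> cyl v" using cyl_nonempty by blast
    then obtain k where k: "k \<in> K" "x \<in> cyl (W k)"
      using assms(3) cyl_subset[of v] v words_subset by blast
    then have "cyl v \<subseteq> cyl (W k)" using N[of k] v x unfolding resolved_def by blast
    then have "weight v = (if cyl v \<subseteq> cyl (W k) then weight v else 0)" by simp
    also have "\<dots> \<le> (\<Sum>k\<in>K. if cyl v \<subseteq> cyl (W k) then weight v else 0)"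
      using k weight_pos[of v] v
      by (intro member_le_sum[of k K "\<lambda>k. if cyl v \<subseteq> cyl (W k) then weight v else 0"])
         (auto simp: words_subset assms(1) intro: less_imp_le)
    finally show "weight v \<le> (\<Sum>k\<in>K. if cyl v \<subseteq> cyl (W k) then weight v else 0)" .
  qed
  also have "\<dots> = (\<Sum>k\<in>K. level_content N (cyl (W k)))"
    unfolding level_content_def by (rule sum.swap)
  also have "\<dots> = (\<Sum>k\<in>K. weight (W k))"
    by (intro sum.cong refl) (use N assms(2) content_eq content_cyl in metis)
  finally show ?thesis .
qed

end

section \<open>The Hausdorff dimension of the attractor\<close>

context ssc_dim
begin

lemma weight_small:
  assumes "0 < e"
  obtains N where "\<And>w. w \<in> wds \<Longrightarrow> N \<le> length w \<Longrightarrow> weight w < e"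
proof -
  have "0 < e powr (1 / s)" using assms by simp
  then obtain N where N: "\<And>w. w \<in> wds \<Longrightarrow> N \<le> length w \<Longrightarrow> word_ratio w < e powr (1 / s)"
    using word_ratio_small by blast
  have "weight w < e" if "w \<in> wds" "N \<le> length w" for w
  proof -
    have "weight w < (e powr (1 / s)) powr s"
      unfolding weight_def using N[OF that] word_ratio_pos[OF that(1)] s_pos
      by (intro powr_less_mono2) auto
    then show ?thesis using s_pos assms by (simp add: powr_powr)
  qed
  then show thesis using that by blast
qed

lemma diameter_cyl_le:
  assumes "w \<in> wds"
  shows "diameter (cyl w) \<le> word_ratio w * diam_bound"
proof (rule diameter_le)
  show "cyl w \<noteq> {} \<or> 0 \<le> word_ratio w * diam_bound" using cyl_nonempty by blast
  show "\<And>x y. x \<in> cyl w \<Longrightarrow> y \<in> cyl w \<Longrightarrow> norm (x - y) \<le> word_ratio w * diam_bound"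
    using dist_cyl_le[OF assms] by (simp add: dist_norm)
qed

lemma bounded_cyl: "w \<in> wds \<Longrightarrow> bounded (cyl w)"
  using bounded_subset[OF compact_imp_bounded[OF compact_E] cyl_subset] .

text \<open>The cylinders of one deep level cost at most a constant times the sum of
  \<open>weight w * word_ratio w powr (s' - s)\<close>. The weights sum to 1 and the other factor is
  uniformly small.\<close>

lemma hausdorff_measure_eq_0:
  assumes "s < s'"
  shows "hausdorff_measure s' E = 0"
proof -
  have s': "0 < s'" using assms s_pos by simp
  have *: "hausdorff_premeasure s' \<delta> E \<le> 0 + ennreal e" if \<delta>: "0 < \<delta>" and e: "0 < e" for \<delta> e
  proof -
    \<comment> \<open>The first term keeps cylinders of ratio below \<open>\<eta>\<close> within
      diameter \<open>\<delta>\<close>; the second is the value at which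
      \<open>\<eta> powr (s' - s) * diam_bound powr s'\<close> equals \<open>e\<close>.\<close>
    define \<eta> where "\<eta> = min (\<delta> / diam_bound) ((e / diam_bound powr s') powr (1 / (s' - s)))"
    have \<eta>: "0 < \<eta>" using \<delta> e diam_bound_pos by (simp add: \<eta>_def)
    have "\<eta> powr (s' - s) \<le> ((e / diam_bound powr s') powr (1 / (s' - s))) powr (s' - s)"
      using assms \<eta> by (intro powr_mono2) (auto simp: \<eta>_def)
    also have "\<dots> = e / diam_bound powr s'"
      using assms e diam_bound_pos by (simp add: powr_powr)
    finally have \<eta>2: "\<eta> powr (s' - s) * diam_bound powr s' \<le> e"
      using diam_bound_pos by (simp add: pos_le_divide_eq)
    obtain N where N: "\<And>w. w \<in> wds \<Longrightarrow> N \<le> length w \<Longrightarrow> word_ratio w < \<eta>"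
      using word_ratio_small[OF \<eta>] by blast
    have small: "word_ratio w < \<eta>" "w \<in> wds" if "w \<in> words N" for w
      using N that by (auto simp: words_def)
    have diam: "diameter (cyl w) \<le> \<delta>" if "w \<in> words N" for w
    proof -
      have "diameter (cyl w) \<le> word_ratio w * diam_bound" using small that diameter_cyl_le by blast
      also have "\<dots> \<le> \<delta> / diam_bound * diam_bound"
        using small(1)[OF that] diam_bound_pos by (intro mult_right_mono) (auto simp: \<eta>_def)
      finally show ?thesis using diam_bound_pos by simp
    qed
    have dp: "diameter_powr s' (cyl w) \<le> ennreal (weight w * e)" if "w \<in> words N" for w
    proof -
      have w: "0 < word_ratio w" using small that word_ratio_pos by blast
      have "diameter (cyl w) powr s' \<le> (word_ratio w * diam_bound) powr s'"
        using s' small that diameter_cyl_le diameter_ge_0[OF bounded_cyl] by (intro powr_mono2) auto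
      also have "\<dots> = word_ratio w powr (s + (s' - s)) * diam_bound powr s'"
        using w diam_bound_pos by (simp add: powr_mult)
      also have "\<dots> = weight w * (word_ratio w powr (s' - s) * diam_bound powr s')"
        unfolding powr_add weight_def by (simp add: mult_ac)
      also have "\<dots> \<le> weight w * (\<eta> powr (s' - s) * diam_bound powr s')"
        using w small[OF that] assms weight_pos[of w]
        by (intro mult_left_mono mult_right_mono powr_mono2) auto
      also have "\<dots> \<le> weight w * e"
        using \<eta>2 weight_pos[of w] small[OF that] by (intro mult_left_mono) auto
      finally show ?thesis using s' cyl_nonempty[of w]
        by (simp add: diameter_powr_def ennreal_leI)
    qed
    obtain h where h: "bij_betw h {0..<card (words N)} (words N)"
      using ex_bij_betw_nat_finite[OF finite_words] by blast
    define U where "U i = (if i < card (words N) then cyl (h i) else {})" for i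
    have hw: "h i \<in> words N" if "i < card (words N)" for i
      using h that by (auto simp: bij_betw_def)
    have U: "E \<subseteq> (\<Union>i. U i)"
    proof
      fix x assume "x \<in> E"
      then obtain w where w: "w \<in> words N" "x \<in> cyl w" using E_covered by blast
      then have "w \<in> h ` {0..<card (words N)}" using h by (simp add: bij_betw_def)
      then obtain i where "i < card (words N)" "w = h i" by auto
      then show "x \<in> (\<Union>i. U i)" using w by (auto simp: U_def intro!: exI[of _ i])
    qed
    have U2: "bounded (U i) \<and> diameter (U i) \<le> \<delta>" for i
      using hw[of i] diam[of "h i"] \<delta> by (auto simp: U_def bounded_cyl words_subset diameter_empty)
    have "hausdorff_premeasure s' \<delta> E \<le> (\<Sum>i. diameter_powr s' (U i))"
      unfolding hausdorff_premeasure_def by (rule INF_lower) (use U U2 in simp)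
    also have "\<dots> = (\<Sum>i\<in>{0..<card (words N)}. diameter_powr s' (U i))"
      by (rule suminf_finite) (auto simp: U_def diameter_powr_def)
    also have "\<dots> = (\<Sum>i\<in>{0..<card (words N)}. diameter_powr s' (cyl (h i)))"
      by (intro sum.cong) (auto simp: U_def)
    also have "\<dots> = (\<Sum>w\<in>words N. diameter_powr s' (cyl w))"
      by (rule sum.reindex_bij_betw[OF h])
    also have "\<dots> \<le> (\<Sum>w\<in>words N. ennreal (weight w * e))"
      by (rule sum_mono) (rule dp)
    also have "\<dots> = ennreal (\<Sum>w\<in>words N. weight w * e)"
      using e weight_pos by (intro sum_ennreal) (auto intro!: mult_nonneg_nonneg less_imp_le simp: words_subset)
    also have "\<dots> = ennreal e" by (simp add: sum_weight_words flip: sum_distrib_right)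
    finally show ?thesis by simp
  qed
  have "hausdorff_premeasure s' \<delta> E \<le> 0" if "0 < \<delta>" for \<delta>
  proof (rule ennreal_le_epsilon)
    fix e :: real assume "0 < e"
    then show "hausdorff_premeasure s' \<delta> E \<le> 0 + ennreal e" using * that by blast
  qed
  then have "hausdorff_measure s' E \<le> 0"
    unfolding hausdorff_measure_def by (intro SUP_least) simp
  then show ?thesis by simp
qed

text \<open>\<open>1 / (gap * rmin)\<close> is the loss in passing from a set to its enclosing
  cylinder; the maximum makes the bound 1 from below immediate, for exponent 0 and for dividing by
  the constant.\<close>

definition mass_const :: "real \<Rightarrow> real" where
  "mass_const s' = max 1 ((1 / (gap * rmin)) powr s')"

text \<open>The mass distribution principle for a single set. The error \<open>e\<close> pays for a
  set that misses \<open>E\<close>, or that has diameter 0 while \<open>s'\<close> is positive; a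
  deep cylinder is taken there.\<close>

lemma enclosing_cylinder_weight:
  assumes U: "bounded U" and e: "0 < e" and s': "0 \<le> s'" "s' \<le> s"
  shows "\<exists>w\<in>wds. U \<inter> E \<subseteq> cyl w \<and>
    ennreal (weight w) \<le> ennreal (mass_const s') * diameter_powr s' U + ennreal e"
proof -
  obtain N where N: "\<And>w. w \<in> wds \<Longrightarrow> N \<le> length w \<Longrightarrow> weight w < e"
    using weight_small[OF e] by blast
  have small: "ennreal (weight w) \<le> ennreal (mass_const s') * diameter_powr s' U + ennreal e"
    if "w \<in> words N" for w
    using N[of w] that by (intro add_increasing ennreal_leI) (auto simp: words_def)
  consider "U \<inter> E = {}" | "U \<inter> E \<noteq> {}" "s' = 0" | "U \<inter> E \<noteq> {}" "0 < s'" "diameter U = 0"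
    | "U \<inter> E \<noteq> {}" "0 < s'" "0 < diameter U"
    using s' diameter_ge_0[OF U] by fastforce
  then show ?thesis
  proof cases
    case 1
    obtain w where "w \<in> words N" using words_nonempty by blast
    then show ?thesis using 1 small by (intro bexI[of _ w]) (auto simp: words_subset)
  next
    case 2
    then have "diameter_powr s' U = 1" by (auto simp: diameter_powr_def)
    moreover have "ennreal 1 \<le> ennreal (mass_const s')" by (intro ennreal_leI) (simp add: mass_const_def)
    ultimately have "ennreal (weight []) \<le> ennreal (mass_const s') * diameter_powr s' U + ennreal e"
      by (simp add: add_increasing2)
    then show ?thesis by (intro bexI[of _ "[]"]) auto
  next
    case 3
    then obtain x where x: "x \<in> U" "x \<in> E" by blast
    obtain w where w: "w \<in> words N" "x \<in> cyl w" using E_covered[OF x(2)] by blast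
    have "U \<inter> E \<subseteq> cyl w"
    proof
      fix y assume "y \<in> U \<inter> E"
      then have "dist x y \<le> 0" using diameter_bounded_bound[OF U x(1), of y] 3 by simp
      then show "y \<in> cyl w" using w by simp
    qed
    then show ?thesis using small[OF w(1)] w by (intro bexI[of _ w]) (auto simp: words_subset)
  next
    case 4
    obtain w where w: "w \<in> wds" "U \<inter> E \<subseteq> cyl w" "word_ratio w \<le> diameter U / (gap * rmin)"
      using enclosing_cylinder[of "U \<inter> E" "diameter U"] 4 diameter_bounded_bound[OF U] by auto
    \<comment> \<open>The ratio is at most 1, so lowering the exponent from \<open>s\<close> to
      \<open>s'\<close> can only increase the power.\<close>
    have "weight w \<le> word_ratio w powr s'"
      unfolding weight_def using s' word_ratio_le_1[OF w(1)] word_ratio_pos[OF w(1)]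
      by (intro powr_mono') auto
    also have "\<dots> \<le> (1 / (gap * rmin) * diameter U) powr s'"
      using w(3) word_ratio_pos[OF w(1)] s' by (intro powr_mono2) auto
    also have "\<dots> = (1 / (gap * rmin)) powr s' * diameter U powr s'"
      by (rule powr_mult)
    also have "\<dots> \<le> mass_const s' * diameter U powr s'"
      unfolding mass_const_def by (intro mult_right_mono) auto
    finally have "ennreal (weight w) \<le> ennreal (mass_const s' * diameter U powr s')" by (rule ennreal_leI)
    also have "\<dots> = ennreal (mass_const s') * diameter_powr s' U"
      using 4 by (subst ennreal_mult) (auto simp: mass_const_def diameter_powr_def)
    finally show ?thesis using w by (intro bexI[of _ w]) (auto intro: add_increasing2)
  qed
qed

text \<open>Each \<open>U i\<close> is exchanged for a cylinder with error
  \<open>(1 / 2) ^ (i + 2)\<close>. The errors total 1/2, and finitely many of the cylinders already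
  cover \<open>E\<close>, so their weights sum to at least 1.\<close>

lemma cover_lower_bound:
  assumes cov: "E \<subseteq> (\<Union>i. U i)" and bdd: "\<And>i::nat. bounded (U i)" and s': "0 \<le> s'" "s' \<le> s"
  shows "1 \<le> ennreal (mass_const s') * (\<Sum>i. diameter_powr s' (U i)) + ennreal (1 / 2)"
proof -
  have "\<exists>w\<in>wds. U i \<inter> E \<subseteq> cyl w \<and>
    ennreal (weight w) \<le> ennreal (mass_const s') * diameter_powr s' (U i) + ennreal ((1 / 2) ^ (i + 2))" for i
    by (rule enclosing_cylinder_weight[OF bdd _ s']) simp
  then obtain W where W: "\<And>i. W i \<in> wds" "\<And>i. U i \<inter> E \<subseteq> cyl (W i)"
    "\<And>i. ennreal (weight (W i)) \<le> ennreal (mass_const s') * diameter_powr s' (U i) + ennreal ((1 / 2) ^ (i + 2))"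
    by metis
  \<comment> \<open>An open set that meets \<open>E\<close> in the cylinder of \<open>W i\<close>
    alone, so compactness yields a finite subcover at no cost in weight.\<close>
  define V where "V i = (\<Union>x\<in>cyl (W i). ball x (gap * word_ratio (W i)))" for i
  have V_sub: "cyl (W i) \<subseteq> V i" for i
  proof
    fix x assume "x \<in> cyl (W i)"
    moreover have "x \<in> ball x (gap * word_ratio (W i))"
      using gap_pos word_ratio_pos[OF W(1)[of i]] by simp
    ultimately show "x \<in> V i" unfolding V_def by blast
  qed
  have V_E: "V i \<inter> E \<subseteq> cyl (W i)" for i
  proof
    fix y assume "y \<in> V i \<inter> E"
    then obtain x where "x \<in> cyl (W i)" "dist x y < gap * word_ratio (W i)" "y \<in> E"
      by (auto simp: V_def)
    then show "y \<in> cyl (W i)" using cyl_saturated[OF W(1)[of i]] unfolding saturated_def by blast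
  qed
  have V_open: "open (V i)" for i by (auto simp: V_def)
  have V_cov: "E \<subseteq> (\<Union>i\<in>UNIV. V i)"
  proof
    fix x assume x: "x \<in> E"
    then obtain i where "x \<in> U i" using cov by blast
    then have "x \<in> V i" using x W(2)[of i] V_sub[of i] by blast
    then show "x \<in> (\<Union>i\<in>UNIV. V i)" by blast
  qed
  obtain K where "K \<subseteq> UNIV" and K: "finite K" "E \<subseteq> (\<Union>i\<in>K. V i)"
    by (rule compactE_image[where f = V and C = UNIV, OF compact_E V_open V_cov])
  have "E \<subseteq> (\<Union>i\<in>K. cyl (W i))"
  proof
    fix x assume x: "x \<in> E"
    then obtain i where "i \<in> K" "x \<in> V i" using K(2) by blast
    then show "x \<in> (\<Union>i\<in>K. cyl (W i))" using x V_E[of i] by blast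
  qed
  then have "1 \<le> (\<Sum>i\<in>K. weight (W i))" using content_cover[OF K(1)] W(1) by blast
  then have "1 \<le> ennreal (\<Sum>i\<in>K. weight (W i))" using ennreal_leI by fastforce
  also have "\<dots> = (\<Sum>i\<in>K. ennreal (weight (W i)))"
    using weight_pos[OF W(1)] by (subst sum_ennreal) (auto intro: less_imp_le)
  also have "\<dots> \<le> (\<Sum>i\<in>K. ennreal (mass_const s') * diameter_powr s' (U i) + ennreal ((1 / 2) ^ (i + 2)))"
    by (rule sum_mono) (rule W(3))
  also have "\<dots> = ennreal (mass_const s') * (\<Sum>i\<in>K. diameter_powr s' (U i)) + ennreal (\<Sum>i\<in>K. (1 / 2) ^ (i + 2))"
    by (simp add: sum.distrib sum_distrib_left sum_ennreal)
  also have "\<dots> \<le> ennreal (mass_const s') * (\<Sum>i. diameter_powr s' (U i)) + ennreal (1 / 2)"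
  proof (intro add_mono mult_left_mono ennreal_leI)
    show "(\<Sum>i\<in>K. diameter_powr s' (U i)) \<le> (\<Sum>i. diameter_powr s' (U i))"
      by (intro sum_le_suminf K) auto
    have "(\<lambda>i. (1 / 4) * (1 / 2 :: real) ^ i) sums ((1 / 4) * (1 / (1 - 1 / 2)))"
      by (intro sums_mult geometric_sums) simp
    then have sums: "(\<lambda>i. (1 / 2 :: real) ^ (i + 2)) sums (1 / 2)"
      by (simp add: power_add power2_eq_square mult_ac)
    show "(\<Sum>i\<in>K. (1 / 2 :: real) ^ (i + 2)) \<le> 1 / 2"
      using sum_le_suminf[OF sums_summable[OF sums] K(1)] sums_unique[OF sums] by simp
  qed simp
  finally show ?thesis .
qed

text \<open>The lower bound for covers does not depend on the mesh, so \<open>\<delta> = 1\<close>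
  gives the contradiction. The range includes \<open>s' = s\<close>, which makes the null exponents
  exactly \<open>{s<..}\<close>.\<close>

lemma hausdorff_measure_neq_0:
  assumes s': "0 \<le> s'" "s' \<le> s"
  shows "hausdorff_measure s' E \<noteq> 0"
proof
  assume 0: "hausdorff_measure s' E = 0"
  \<comment> \<open>Then \<open>mass_const s' * c\<close> is 1/4, and 1/4 + 1/2 falls short of
    1.\<close>
  define c where "c = 1 / (4 * mass_const s')"
  have m: "1 \<le> mass_const s'" by (simp add: mass_const_def)
  have "hausdorff_premeasure s' 1 E \<le> hausdorff_measure s' E"
    unfolding hausdorff_measure_def by (rule SUP_upper) simp
  then have "hausdorff_premeasure s' 1 E < ennreal c" using 0 m by (simp add: c_def)
  then obtain U where U: "E \<subseteq> (\<Union>i. U i)" "\<And>i::nat. bounded (U i)"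
    and lt: "(\<Sum>i. diameter_powr s' (U i)) < ennreal c"
    unfolding hausdorff_premeasure_def INF_less_iff by blast
  have "1 \<le> ennreal (mass_const s') * (\<Sum>i. diameter_powr s' (U i)) + ennreal (1 / 2)"
    by (rule cover_lower_bound[OF U s'])
  also have "\<dots> \<le> ennreal (mass_const s') * ennreal c + ennreal (1 / 2)"
    using lt by (intro add_mono mult_left_mono) auto
  also have "\<dots> = ennreal (1 / 4 + 1 / 2)"
    using m by (simp add: c_def del: ennreal_half flip: ennreal_mult ennreal_plus)
  also have "\<dots> < ennreal 1" by (subst ennreal_less_iff) auto
  finally show False by simp
qed

lemma hausdorff_dim_eq: "hausdorff_dim E = ereal s"
proof -
  have eq: "{s'. 0 \<le> s' \<and> hausdorff_measure s' E = 0} = {s<..}"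
    using hausdorff_measure_eq_0 hausdorff_measure_neq_0 s_pos by force
  show ?thesis unfolding hausdorff_dim_def eq
  proof (rule antisym)
    show "Inf (ereal ` {s<..}) \<le> ereal s"
    proof (rule ereal_le_epsilon2)
      fix e :: real assume "0 < e"
      then show "Inf (ereal ` {s<..}) \<le> ereal s + ereal e" by (intro INF_lower2[of "s + e"]) auto
    qed
  qed (auto intro: INF_greatest)
qed

end

section \<open>The Moran equation recovered from the dimension\<close>

context ssc_ifs
begin

text \<open>Intermediate value theorem: the sum is \<open>n\<close> at exponent 0 and at most 1 at
  an \<open>N\<close> with \<open>rmax ^ N < 1 / n\<close>.\<close>

lemma moran_solution_exists: "\<exists>s. (\<Sum>i\<in>{1..n}. r i powr s) = 1"
proof -
  obtain N where N: "rmax ^ N < 1 / n"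
    using real_arch_pow_inv[OF _ rmax_less_1, of "1 / n"] n_ge_2 by auto
  have "(\<Sum>i\<in>{1..n}. r i powr real N) \<le> (\<Sum>i\<in>{1..n}. 1 / n)"
  proof (rule sum_mono)
    fix i assume i: "i \<in> {1..n}"
    have "r i powr real N = r i ^ N" using ratio_bounds[OF i] by (simp add: powr_realpow)
    also have "\<dots> \<le> rmax ^ N" using ratio_bounds[OF i] le_rmax[OF i] by (intro power_mono) auto
    finally show "r i powr real N \<le> 1 / n" using N by simp
  qed
  then have 1: "(\<Sum>i\<in>{1..n}. r i powr real N) \<le> 1" using n_ge_2 by simp
  have "(\<Sum>i\<in>{1..n}. r i powr 0) = (\<Sum>i\<in>{1..n}. 1)"
    using ratio_bounds by (intro sum.cong) (auto simp: less_le)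
  then have 2: "1 \<le> (\<Sum>i\<in>{1..n}. r i powr 0)" using n_ge_2 by simp
  have "\<forall>x. 0 \<le> x \<and> x \<le> real N \<longrightarrow> isCont (\<lambda>x. \<Sum>i\<in>{1..n}. r i powr x) x"
    using ratio_bounds by (intro allI impI continuous_intros) (auto simp: less_le)
  then show ?thesis using IVT2[of "\<lambda>x. \<Sum>i\<in>{1..n}. r i powr x" "real N" 1 0] 1 2 by auto
qed

text \<open>The dimension formula for a Moran exponent \<open>s0\<close> forces
  \<open>s = s0\<close>, which turns the dimension hypothesis into the equation behind the
  content.\<close>

lemma moran_of_hausdorff_dim:
  assumes "hausdorff_dim E = ereal s"
  shows "ssc_dim n S r E s"
proof -
  obtain s0 where s0: "(\<Sum>i\<in>{1..n}. r i powr s0) = 1" using moran_solution_exists by blast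
  interpret D: ssc_dim n S r E s0 by unfold_locales (rule s0)
  have "s = s0" using D.hausdorff_dim_eq assms by simp
  then show ?thesis using D.ssc_dim_axioms by simp
qed

end

section \<open>Images of cylinders under a bi-Lipschitz bijection\<close>

locale lipschitz_pair =
  A: ssc_dim n S r E s + B: ssc_dim m T t F s
  for n :: nat and S :: "nat \<Rightarrow> 'a::euclidean_space \<Rightarrow> 'a" and r :: "nat \<Rightarrow> real" and E :: "'a set" and s :: real
    and m :: nat and T :: "nat \<Rightarrow> 'b::euclidean_space \<Rightarrow> 'b" and t :: "nat \<Rightarrow> real" and F :: "'b set" +
  fixes f :: "'a \<Rightarrow> 'b" and L :: real
  assumes L: "1 \<le> L" and bij: "bij_betw f E F"
    and dist_lower: "\<And>x y. x \<in> E \<Longrightarrow> y \<in> E \<Longrightarrow> inverse L * dist x y \<le> dist (f x) (f y)"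
    and dist_upper: "\<And>x y. x \<in> E \<Longrightarrow> y \<in> E \<Longrightarrow> dist (f x) (f y) \<le> L * dist x y"
begin

lemma image_E: "f ` E = F"
  using bij by (simp add: bij_betw_def)

lemma inj: "inj_on f E"
  using bij by (simp add: bij_betw_def)

lemma image_saturated:
  assumes "A \<subseteq> E" "A.saturated c A"
  shows "B.saturated (c / L) (f ` A)"
  unfolding B.saturated_def
proof (intro ballI impI)
  fix y z assume "y \<in> f ` A" "z \<in> F" and d: "dist y z < c / L"
  then obtain y' z' where y': "y' \<in> A" "y = f y'" and z': "z' \<in> E" "z = f z'" using image_E by blast
  have "inverse L * dist y' z' < inverse L * c"
    using dist_lower[of y' z'] y' z' d assms(1) by (auto simp: divide_inverse mult.commute)
  then have "dist y' z' < c" using L by simp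
  then show "z \<in> f ` A" using assms(2) y' z' unfolding A.saturated_def by blast
qed

lemma simple_image:
  assumes "A.simple A"
  shows "B.simple (f ` A)"
proof -
  obtain c where c: "0 < c" "A.saturated c A" and sub: "A \<subseteq> E" using assms by (auto simp: A.simple_def)
  have "0 < c / L" using c L by simp
  then show ?thesis
    using image_saturated[OF sub c(2)] sub image_E unfolding B.simple_def by blast
qed

text \<open>The upper Lipschitz bound carries the radius backwards, so finite unions of cylinders of
  \<open>F\<close> pull back to finite unions of cylinders of \<open>E\<close>.\<close>

lemma simple_preimage:
  assumes "B.simple X"
  shows "A.simple {x \<in> E. f x \<in> X}"
proof -
  obtain c where c: "0 < c" "B.saturated c X" using assms by (auto simp: B.simple_def)
  have "A.saturated (c / L) {x \<in> E. f x \<in> X}"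
    unfolding A.saturated_def
  proof (intro ballI impI)
    fix x y assume x: "x \<in> {x \<in> E. f x \<in> X}" and y: "y \<in> E" and d: "dist x y < c / L"
    have "dist (f x) (f y) \<le> L * dist x y" using x y dist_upper by simp
    also have "\<dots> < c" using d L by (simp add: pos_less_divide_eq mult.commute)
    finally have "f y \<in> X" using c(2) x y image_E unfolding B.saturated_def by blast
    then show "y \<in> {x \<in> E. f x \<in> X}" using y by simp
  qed
  moreover have "0 < c / L" using c L by simp
  ultimately show ?thesis unfolding A.simple_def by blast
qed

lemma disjoint_family_image_cyl:
  assumes "u \<in> A.wds" "K \<subseteq> A.words N"
  shows "disjoint_family_on (\<lambda>v. f ` A.cyl (u @ v)) K"
  unfolding disjoint_family_on_def
proof (intro ballI impI)
  fix v w assume vw: "v \<in> K" "w \<in> K" "v \<noteq> w"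
  then have "A.cyl (u @ v) \<inter> A.cyl (u @ w) = {}"
    using A.disjoint_family_cyl[OF assms] unfolding disjoint_family_on_def by blast
  moreover have "A.cyl (u @ v) \<subseteq> E" "A.cyl (u @ w) \<subseteq> E"
    using vw assms A.words_subset by (auto intro!: A.cyl_subset del: subsetI)
  ultimately show "f ` A.cyl (u @ v) \<inter> f ` A.cyl (u @ w) = {}"
    using inj_on_image_Int[OF inj, of "A.cyl (u @ v)" "A.cyl (u @ w)"] by simp
qed

lemma content_image_UN:
  assumes "u \<in> A.wds" "K \<subseteq> A.words N"
  shows "B.content (f ` (\<Union>v\<in>K. A.cyl (u @ v))) = (\<Sum>v\<in>K. B.content (f ` A.cyl (u @ v)))"
  unfolding image_UN
proof (rule B.content_UN)
  show "finite K" using assms(2) finite_subset A.finite_words by blast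
  fix v assume "v \<in> K"
  then show "B.simple (f ` A.cyl (u @ v))"
    using assms by (intro simple_image A.simple_cyl) (auto simp: A.words_subset subset_iff)
qed (rule disjoint_family_image_cyl[OF assms])

text \<open>The words \<open>v\<close> of length at most 1 give \<open>u\<close> itself and its
  children. One \<open>w\<close> and one level serve them all, so that \<open>B.weight w\<close>
  cancels in a child-to-parent ratio.\<close>

definition resolves :: "nat \<Rightarrow> nat list \<Rightarrow> nat list \<Rightarrow> bool" where
  "resolves N u w \<longleftrightarrow> (\<forall>v\<in>A.wds. length v \<le> 1 \<longrightarrow> (\<forall>k\<in>B.words N.
     B.cyl (w @ k) \<subseteq> f ` A.cyl (u @ v) \<or> B.cyl (w @ k) \<inter> f ` A.cyl (u @ v) = {}))"

text \<open>The constant \<open>C\<close> will bound the density; the common \<open>N\<close> will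
  make its ratios finite in number.\<close>

definition uniform_resolution :: "nat \<Rightarrow> real \<Rightarrow> bool" where
  "uniform_resolution N C \<longleftrightarrow> 0 < C \<and> (\<forall>u\<in>A.wds. \<exists>w\<in>B.wds. f ` A.cyl u \<subseteq> B.cyl w \<and>
     B.word_ratio w \<le> C * A.word_ratio u \<and> resolves N u w)"

text \<open>The level \<open>N\<close> does not depend on \<open>u\<close>, so up to scaling only finitely many shapes of images occur.\<close>

lemma uniform_resolution_exists: "\<exists>N C. uniform_resolution N C"
proof -
  \<comment> \<open>The factor given by \<open>B.enclosing_cylinder\<close> for an image of diameter
    at most \<open>L * (A.word_ratio u * A.diam_bound)\<close>.\<close>
  define C where "C = L * A.diam_bound / (B.gap * B.rmin)"
  have C: "0 < C" using L A.diam_bound_pos B.gap_pos B.rmin_pos by (simp add: C_def)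
  \<comment> \<open>Solves \<open>C * e * B.diam_bound = A.gap * A.rmin / L\<close>: cylinders
    \<open>N\<close> levels below \<open>w\<close> are then smaller than the saturation radius of
    the image of \<open>u\<close> and of each child.\<close>
  define e where "e = A.gap * A.rmin / (L * B.diam_bound * C)"
  have e: "0 < e" using C L B.diam_bound_pos A.gap_pos A.rmin_pos by (simp add: e_def)
  obtain N where N: "\<And>w. w \<in> B.wds \<Longrightarrow> N \<le> length w \<Longrightarrow> B.word_ratio w < e"
    using B.word_ratio_small[OF e] by blast
  have "\<exists>w\<in>B.wds. f ` A.cyl u \<subseteq> B.cyl w \<and> B.word_ratio w \<le> C * A.word_ratio u \<and> resolves N u w"
    if u: "u \<in> A.wds" for u
  proof -
    have ru: "0 < A.word_ratio u" using A.word_ratio_pos[OF u] .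
    have "f ` A.cyl u \<subseteq> F" "f ` A.cyl u \<noteq> {}"
      using A.cyl_subset[OF u] image_E A.cyl_nonempty[of u] by auto
    moreover have "0 < L * (A.word_ratio u * A.diam_bound)" using L ru A.diam_bound_pos by simp
    moreover have "dist x y \<le> L * (A.word_ratio u * A.diam_bound)"
      if "x \<in> f ` A.cyl u" "y \<in> f ` A.cyl u" for x y
    proof -
      obtain x' where x': "x' \<in> A.cyl u" "x = f x'" using \<open>x \<in> f ` A.cyl u\<close> by auto
      obtain y' where y': "y' \<in> A.cyl u" "y = f y'" using \<open>y \<in> f ` A.cyl u\<close> by auto
      have "dist x y \<le> L * dist x' y'" using dist_upper x' y' A.cyl_subset[OF u] by blast
      also have "\<dots> \<le> L * (A.word_ratio u * A.diam_bound)"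
        using L A.dist_cyl_le[OF u] x' y' by (intro mult_left_mono) auto
      finally show ?thesis .
    qed
    ultimately obtain w where w: "w \<in> B.wds" "f ` A.cyl u \<subseteq> B.cyl w"
      "B.word_ratio w \<le> L * (A.word_ratio u * A.diam_bound) / (B.gap * B.rmin)"
      using B.enclosing_cylinder by blast
    have wr: "B.word_ratio w \<le> C * A.word_ratio u" using w(3) by (simp add: C_def mult_ac)
    have "B.cyl (w @ k) \<subseteq> f ` A.cyl (u @ v) \<or> B.cyl (w @ k) \<inter> f ` A.cyl (u @ v) = {}"
      if v: "v \<in> A.wds" "length v \<le> 1" and k: "k \<in> B.words N" for v k
    proof (rule B.cyl_subset_or_disjoint)
      have "A.rmin \<le> A.word_ratio v"
        using v A.rmin_le A.rmin_less_1 by (cases v) (auto simp: A.word_ratio_Cons)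
      then have rv: "A.word_ratio u * A.rmin \<le> A.word_ratio (u @ v)"
        using ru by (simp add: A.word_ratio_append)
      have kN: "B.word_ratio k < e" "k \<in> B.wds" using N[of k] k by (auto simp: B.words_def)
      have "B.word_ratio (w @ k) * B.diam_bound \<le> C * A.word_ratio u * B.word_ratio k * B.diam_bound"
        unfolding B.word_ratio_append
        using wr B.word_ratio_pos[OF kN(2)] B.diam_bound_pos by (intro mult_right_mono) auto
      also have "\<dots> < C * A.word_ratio u * e * B.diam_bound"
        using kN(1) C ru B.diam_bound_pos by simp
      also have "\<dots> = A.gap * (A.word_ratio u * A.rmin) / L"
        using C L B.diam_bound_pos by (simp add: e_def)
      also have "\<dots> \<le> A.gap * A.word_ratio (u @ v) / L"
        using rv L A.gap_pos by (intro divide_right_mono mult_left_mono) auto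
      finally show "B.word_ratio (w @ k) * B.diam_bound < A.gap * A.word_ratio (u @ v) / L" .
      show "B.saturated (A.gap * A.word_ratio (u @ v) / L) (f ` A.cyl (u @ v))"
        using u v by (intro image_saturated A.cyl_saturated A.cyl_subset) auto
      show "w @ k \<in> B.wds" using w kN by simp
    qed
    then show ?thesis using w wr unfolding resolves_def by blast
  qed
  then show ?thesis using C unfolding uniform_resolution_def by blast
qed

section \<open>The density of the image content and its local constancy\<close>

definition density :: "nat list \<Rightarrow> real" where
  "density u = B.content (f ` A.cyl u) / A.weight u"

lemma content_image_pos: "u \<in> A.wds \<Longrightarrow> 0 < B.content (f ` A.cyl u)"
  using A.cyl_nonempty by (intro B.content_pos simple_image A.simple_cyl) auto

lemma density_pos: "u \<in> A.wds \<Longrightarrow> 0 < density u"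
  using content_image_pos A.weight_pos by (simp add: density_def)

lemma content_image: "u \<in> A.wds \<Longrightarrow> B.content (f ` A.cyl u) = density u * A.weight u"
  using A.weight_pos[of u] by (simp add: density_def)

text \<open>Additivity of the content over the children; as the coefficients
  \<open>r i powr s\<close> sum to 1, this is a martingale identity.\<close>

lemma density_average:
  assumes u: "u \<in> A.wds"
  shows "(\<Sum>i\<in>{1..n}. r i powr s * density (u @ [i])) = density u"
proof -
  have "A.weight u * density u = B.content (f ` A.cyl u)" using content_image[OF u] by simp
  also have "A.cyl u = (\<Union>v\<in>A.words 1. A.cyl (u @ v))"
  proof (intro subset_antisym subsetI)
    fix x assume "x \<in> A.cyl u"
    then show "x \<in> (\<Union>v\<in>A.words 1. A.cyl (u @ v))" using A.cyl_covered by blast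
  next
    fix x assume "x \<in> (\<Union>v\<in>A.words 1. A.cyl (u @ v))"
    then show "x \<in> A.cyl u" using A.cyl_append_subset A.words_subset by blast
  qed
  also have "B.content (f ` \<dots>) = (\<Sum>v\<in>A.words 1. B.content (f ` A.cyl (u @ v)))"
    by (rule content_image_UN[OF u subset_refl])
  also have "\<dots> = (\<Sum>i\<in>{1..n}. B.content (f ` A.cyl (u @ [i])))"
    using A.sum_words_Suc[of "\<lambda>v. B.content (f ` A.cyl (u @ v))" 0] by (simp add: A.words_0 One_nat_def)
  also have "\<dots> = (\<Sum>i\<in>{1..n}. A.weight u * (r i powr s * density (u @ [i])))"
    by (intro sum.cong refl) (use u in \<open>simp add: content_image A.weight_append A.weight_single\<close>)
  also have "\<dots> = A.weight u * (\<Sum>i\<in>{1..n}. r i powr s * density (u @ [i]))"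
    by (rule sum_distrib_left[symmetric])
  finally show ?thesis using A.weight_pos[OF u] by simp
qed

text \<open>Parent and child contents are both \<open>B.weight w\<close> times a sum over a subset
  of \<open>B.words N\<close>. In the quotient \<open>B.weight w\<close> cancels, leaving one value
  for each pair of subsets and each letter.\<close>

lemma density_ratios_finite:
  obtains D where "finite D"
    and "\<And>u i. u \<in> A.wds \<Longrightarrow> i \<in> {1..n} \<Longrightarrow> \<exists>d\<in>D. density (u @ [i]) = d * density u"
proof -
  obtain N C where NC: "uniform_resolution N C" using uniform_resolution_exists by blast
  define D where "D = (\<lambda>(K, K', i). sum B.weight K' / sum B.weight K / r i powr s) `
    (Pow (B.words N) \<times> Pow (B.words N) \<times> {1..n})"
  have "finite D" by (simp add: D_def)
  moreover have "\<exists>d\<in>D. density (u @ [i]) = d * density u" if u: "u \<in> A.wds" and i: "i \<in> {1..n}" for u i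
  proof -
    obtain w where w: "w \<in> B.wds" "f ` A.cyl u \<subseteq> B.cyl w"
      and "resolves N u w"
      using NC u unfolding uniform_resolution_def by blast
    then have res: "B.cyl (w @ k) \<subseteq> f ` A.cyl (u @ v) \<or> B.cyl (w @ k) \<inter> f ` A.cyl (u @ v) = {}"
      if "v \<in> A.wds" "length v \<le> 1" "k \<in> B.words N" for v k
      using that unfolding resolves_def by blast
    define K where "K v = {k \<in> B.words N. B.cyl (w @ k) \<subseteq> f ` A.cyl (u @ v)}" for v
    have content: "B.content (f ` A.cyl (u @ v)) = B.weight w * sum B.weight (K v)"
      if v: "v \<in> A.wds" "length v \<le> 1" for v
      unfolding K_def
    proof (rule B.content_subset_cyl[OF _ w(1) res[OF v]])
      show "f ` A.cyl (u @ v) \<subseteq> B.cyl w" using w(2) A.cyl_append_subset[OF v(1), of u] by blast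
    qed
    have c1: "B.content (f ` A.cyl u) = B.weight w * sum B.weight (K [])" using content[of "[]"] by simp
    have c2: "B.content (f ` A.cyl (u @ [i])) = B.weight w * sum B.weight (K [i])"
      using content[of "[i]"] i by simp
    have "sum B.weight (K []) \<noteq> 0" using c1 content_image_pos[OF u] by auto
    then have "density (u @ [i]) = sum B.weight (K [i]) / sum B.weight (K []) / r i powr s * density u"
      unfolding density_def c1 c2 using u i by (simp add: A.weight_append A.weight_single mult_ac)
    moreover have "sum B.weight (K [i]) / sum B.weight (K []) / r i powr s \<in> D"
      unfolding D_def by (intro image_eqI[of _ _ "(K [], K [i], i)"]) (use i in \<open>auto simp: K_def\<close>)
    ultimately show ?thesis by blast
  qed
  ultimately show thesis using that by blast
qed

text \<open>The image lies in one cylinder of ratio at most \<open>C\<close> times that of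
  \<open>u\<close>; raising to the common exponent \<open>s\<close> compares its content with
  \<open>A.weight u\<close>.\<close>

lemma density_bounded: "bdd_above (density ` A.wds)"
proof -
  obtain N C where NC: "uniform_resolution N C" using uniform_resolution_exists by blast
  have "density u \<le> C powr s" if u: "u \<in> A.wds" for u
  proof -
    obtain w where w: "w \<in> B.wds" "f ` A.cyl u \<subseteq> B.cyl w" "B.word_ratio w \<le> C * A.word_ratio u"
      using NC u unfolding uniform_resolution_def by blast
    have "B.content (f ` A.cyl u) \<le> B.content (B.cyl w)"
      using w u by (intro B.content_mono simple_image A.simple_cyl B.simple_cyl)
    also have "\<dots> = B.word_ratio w powr s" using B.content_cyl[OF w(1)] by (simp add: B.weight_def)
    also have "\<dots> \<le> (C * A.word_ratio u) powr s"
      using w(3) B.word_ratio_pos[OF w(1)] A.s_pos by (intro powr_mono2) auto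
    also have "\<dots> = C powr s * A.weight u" by (simp add: powr_mult A.weight_def)
    finally show ?thesis using A.weight_pos[OF u] by (simp add: density_def pos_divide_le_eq)
  qed
  then show ?thesis by (auto intro!: bdd_aboveI2)
qed

text \<open>Near the supremum of the density no child can have a larger density, because the child-to-parent
  ratios of densities lie in a finite set; since a parent's density is the mean of its children's,
  all of them agree.\<close>

lemma density_locally_constant:
  obtains u where "u \<in> A.wds" and "\<And>v. v \<in> A.wds \<Longrightarrow> density (u @ v) = density u"
proof -
  obtain D where D: "finite D"
    and ratio: "\<And>u i. u \<in> A.wds \<Longrightarrow> i \<in> {1..n} \<Longrightarrow> \<exists>d\<in>D. density (u @ [i]) = d * density u"
    using density_ratios_finite by blast
  \<comment> \<open>The least ratio above 1, capped at 2; the entry 2 also keeps the set nonempty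
    when no ratio exceeds 1.\<close>
  define \<eta> where "\<eta> = Min (insert 2 {d \<in> D. 1 < d})"
  have \<eta>: "1 < \<eta>" "\<And>d. d \<in> D \<Longrightarrow> 1 < d \<Longrightarrow> \<eta> \<le> d"
    using D by (auto simp: \<eta>_def)
  define M where "M = Sup (density ` A.wds)"
  have le_M: "density u \<le> M" if "u \<in> A.wds" for u
    unfolding M_def using that density_bounded by (intro cSup_upper) auto
  have "0 < M" using le_M[of "[]"] density_pos[of "[]"] by simp
  then have "M / \<eta> < M" using \<eta>(1) by (simp add: pos_divide_less_eq)
  moreover have "density ` A.wds \<noteq> {}" using A.wds_Nil by blast
  ultimately obtain u where u: "u \<in> A.wds" and large: "M / \<eta> < density u"
    unfolding M_def using less_cSupE[of "M / \<eta>" "density ` A.wds"] by (auto simp: M_def)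
  have "density (u @ v) = density u" if "v \<in> A.wds" for v
    using that
  \<comment> \<open>Appending letters at the end keeps the parent's density equal to that of
    \<open>u\<close>, so the margin below \<open>M\<close> is the same in every generation.\<close>
  proof (induction v rule: rev_induct)
    case (snoc i v)
    then have i: "i \<in> {1..n}" and v: "v \<in> A.wds" and IH: "density (u @ v) = density u" by auto
    have uv: "u @ v \<in> A.wds" using u v by simp
    have le: "density ((u @ v) @ [j]) \<le> density u" if j: "j \<in> {1..n}" for j
    proof -
      obtain d where d: "d \<in> D" "density ((u @ v) @ [j]) = d * density u"
        using ratio[OF uv j] IH by metis
      have "d \<le> 1"
      proof (rule ccontr)
        assume "\<not> d \<le> 1"
        then have "\<eta> * density u \<le> d * density u"
          using \<eta>(2) d(1) density_pos[OF u] by (intro mult_right_mono) auto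
        moreover have "M < \<eta> * density u" using large \<eta>(1) by (simp add: pos_divide_less_eq mult.commute)
        moreover have "d * density u \<le> M" using le_M[of "(u @ v) @ [j]"] d(2) uv j by simp
        ultimately show False by simp
      qed
      then show ?thesis using d(2) density_pos[OF u] mult_right_mono[of d 1 "density u"] by simp
    qed
    have w: "0 < r j powr s" if "j \<in> {1..n}" for j
      using A.ratio_bounds[OF that] by simp
    show ?case
    proof (rule ccontr)
      assume "density (u @ v @ [i]) \<noteq> density u"
      then have "density ((u @ v) @ [i]) < density u" using le[OF i] by simp
      then have "(\<Sum>j\<in>{1..n}. r j powr s * density ((u @ v) @ [j])) < (\<Sum>j\<in>{1..n}. r j powr s * density u)"
        using i w le by (intro sum_strict_mono_ex1) (auto intro!: mult_left_mono less_imp_le[OF w])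
      then show False
        using density_average[OF uv] IH A.moran by (simp flip: sum_distrib_right)
    qed
  qed simp
  then show thesis using that u by blast
qed

text \<open>The content of \<open>X\<close> is computed in two ways, within \<open>F\<close> and
  through \<open>E\<close>, and the common factor \<open>B.content G\<close> cancels. Nonemptiness
  of \<open>W\<close> is recorded because the semiring has no empty sum.\<close>

lemma ratio_power_eq_sum:
  assumes j: "j \<in> {1..m}"
  obtains W where "finite W" "W \<noteq> {}" "W \<subseteq> A.wds" "t j powr s = (\<Sum>v\<in>W. A.weight v)"
proof -
  obtain u where u: "u \<in> A.wds" and const: "\<And>v. v \<in> A.wds \<Longrightarrow> density (u @ v) = density u"
    using density_locally_constant by blast
  define G where "G = f ` A.cyl u"
  have G: "B.simple G" "0 < B.content G"
    using simple_image[OF A.simple_cyl[OF u]] content_image_pos[OF u] by (simp_all add: G_def)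
  obtain N where N: "B.resolved N G" using B.simple_resolved2[OF G(1) G(1)] by blast
  define K where "K = {w \<in> B.words N. B.cyl w \<subseteq> G}"
  have KN: "K \<subseteq> B.words N" by (auto simp: K_def)
  have finK: "finite K" using KN finite_subset B.finite_words by blast
  have Kw: "w \<in> B.wds" if "w \<in> K" for w using that KN B.words_subset by blast
  have content_G: "B.content G = (\<Sum>w\<in>K. B.weight w)"
    using N by (simp add: B.content_eq B.level_content_def K_def sum.If_cases Int_def conj_commute)
  define X where "X = (\<Union>w\<in>K. B.cyl (w @ [j]))"
  have simple_X: "B.simple X"
    unfolding X_def using finK Kw j by (intro B.simple_UN B.simple_cyl) auto
  have content_X: "B.content X = t j powr s * B.content G"
  proof -
    have "B.content X = (\<Sum>w\<in>K. B.content (B.cyl (w @ [j])))"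
      unfolding X_def
    proof (rule B.content_UN[OF finK])
      show "disjoint_family_on (\<lambda>w. B.cyl (w @ [j])) K"
        unfolding disjoint_family_on_def
      proof (intro ballI impI)
        fix v w assume "v \<in> K" "w \<in> K" "v \<noteq> w"
        then show "B.cyl (v @ [j]) \<inter> B.cyl (w @ [j]) = {}"
          using j by (intro B.cyl_disjoint) (auto simp: K_def B.words_def)
      qed
    qed (use Kw j in \<open>auto intro: B.simple_cyl\<close>)
    also have "\<dots> = (\<Sum>w\<in>K. B.weight w * t j powr s)"
      by (intro sum.cong refl) (use Kw j in \<open>simp add: B.content_cyl B.weight_append B.weight_single\<close>)
    finally show ?thesis by (simp add: content_G mult.commute flip: sum_distrib_right)
  qed
  have "X \<subseteq> G"
    unfolding X_def using B.cyl_append_subset[of "[j]"] j by (fastforce simp: K_def)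
  define P where "P = {x \<in> E. f x \<in> X}"
  have fP: "f ` P = X" using \<open>X \<subseteq> G\<close> A.cyl_subset[OF u] by (auto simp: P_def G_def)
  have P: "P \<subseteq> A.cyl u"
  proof
    fix x assume "x \<in> P"
    then have "x \<in> E" "f x \<in> f ` A.cyl u" using \<open>X \<subseteq> G\<close> by (auto simp: P_def G_def)
    then show "x \<in> A.cyl u" using inj_on_image_mem_iff[OF inj _ A.cyl_subset[OF u]] by blast
  qed
  obtain M where M: "\<And>M'. M \<le> M' \<Longrightarrow> A.resolved M' P"
    using A.simple_resolved[OF simple_preimage[OF simple_X]] unfolding P_def by blast
  define W where "W = {v \<in> A.words M. A.cyl (u @ v) \<subseteq> P}"
  have WM: "W \<subseteq> A.words M" by (auto simp: W_def)
  have Ww: "v \<in> A.wds" if "v \<in> W" for v using that WM A.words_subset by blast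
  have "P = (\<Union>v\<in>W. A.cyl (u @ v))"
    unfolding W_def
  proof (rule A.subset_cyl_eq_UN[OF P])
    fix v assume "v \<in> A.words M"
    \<comment> \<open>Levels resolving \<open>P\<close> are counted from the root; the words
      \<open>u @ v\<close> have level \<open>length u + M\<close>, which is at least
      \<open>M\<close>.\<close>
    then have "u @ v \<in> A.words (length u + M)" using u by (auto simp: A.words_def)
    then show "A.cyl (u @ v) \<subseteq> P \<or> A.cyl (u @ v) \<inter> P = {}"
      using M[of "length u + M"] unfolding A.resolved_def by simp
  qed
  then have "B.content X = (\<Sum>v\<in>W. B.content (f ` A.cyl (u @ v)))"
    using content_image_UN[OF u WM] fP by simp
  \<comment> \<open>Constancy of the density below \<open>u\<close> enters here: the contents of the
    images become proportional to the weights.\<close>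
  also have "\<dots> = (\<Sum>v\<in>W. density u * A.weight u * A.weight v)"
    by (intro sum.cong refl) (use u Ww const in \<open>simp add: content_image A.weight_append\<close>)
  also have "\<dots> = B.content G * (\<Sum>v\<in>W. A.weight v)"
    using content_image[OF u] by (simp add: G_def sum_distrib_left)
  finally have eq: "t j powr s = (\<Sum>v\<in>W. A.weight v)"
    using content_X G(2) by (simp add: mult.commute)
  moreover have "W \<noteq> {}" using eq B.ratio_bounds[OF j] by auto
  moreover have "finite W" using WM finite_subset A.finite_words by blast
  ultimately show thesis using that Ww by blast
qed

lemma ratio_power_in_adjoin:
  assumes "j \<in> {1..m}"
  shows "t j powr s \<in> pos_int_adjoin ((\<lambda>i. r i powr s) ` {1..n})" (is "_ \<in> ?R")
proof -
  have weight: "A.weight v \<in> ?R" if "v \<in> A.wds" for v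
    using that
  proof (induction v)
    case Nil
    \<comment> \<open>The empty word has weight 1, which is present as a positive integer.\<close>
    then show ?case using pos_int_adjoin.pos_int[of 1] by simp
  next
    case (Cons i v)
    then have "A.weight ([i] @ v) = r i powr s * A.weight v"
      by (subst A.weight_append) (auto simp: A.weight_single)
    then show ?case using Cons by (auto intro!: pos_int_adjoin.mult intro: pos_int_adjoin.gen)
  qed
  have sums: "(\<Sum>v\<in>W. A.weight v) \<in> ?R" if "finite W" "W \<noteq> {}" "W \<subseteq> A.wds" for W
    using that by (induction W rule: finite_ne_induct) (auto intro: weight pos_int_adjoin.add)
  show ?thesis using ratio_power_eq_sum[OF assms] sums by metis
qed

end

section \<open>Comparison of the two semirings\<close>

lemma pos_int_adjoin_subset:
  assumes "X \<subseteq> pos_int_adjoin Y"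
  shows "pos_int_adjoin X \<subseteq> pos_int_adjoin Y"
proof
  fix x assume "x \<in> pos_int_adjoin X"
  then show "x \<in> pos_int_adjoin Y"
    by induction (use assms in \<open>auto intro: pos_int_adjoin.intros\<close>)
qed

text \<open>The two-sided inequality passes to the inverse map with the same
  \<open>L\<close>.\<close>

lemma lipschitz_equivalent_sym:
  assumes "lipschitz_equivalent A B"
  shows "lipschitz_equivalent B A"
proof -
  obtain f L where L: "1 \<le> L" and bij: "bij_betw f A B"
    and d: "\<And>x y. x \<in> A \<Longrightarrow> y \<in> A \<Longrightarrow> inverse L * dist x y \<le> dist (f x) (f y) \<and> dist (f x) (f y) \<le> L * dist x y"
    using assms unfolding lipschitz_equivalent_def by blast
  let ?g = "inv_into A f"
  have "inverse L * dist x y \<le> dist (?g x) (?g y) \<and> dist (?g x) (?g y) \<le> L * dist x y"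
    if "x \<in> B" "y \<in> B" for x y
  proof -
    have "?g x \<in> A" "?g y \<in> A" "f (?g x) = x" "f (?g y) = y"
      using that bij by (auto simp: bij_betw_def inv_into_into f_inv_into_f)
    then show ?thesis using d[of "?g x" "?g y"] L by (simp add: field_simps)
  qed
  then show ?thesis
    unfolding lipschitz_equivalent_def using L bij_betw_inv_into[OF bij] by blast
qed

text \<open>The hypotheses are symmetric in the two systems, so exchanging them turns this one
  inclusion into equality.\<close>

lemma adjoin_subset_of_lipschitz_equivalent:
  fixes S :: "nat \<Rightarrow> 'a::euclidean_space \<Rightarrow> 'a" and T :: "nat \<Rightarrow> 'b::euclidean_space \<Rightarrow> 'b"
  assumes "ssc_dim n S r E s" "ssc_dim m T t F s" "lipschitz_equivalent E F"
  shows "pos_int_adjoin ((\<lambda>j. t j powr s) ` {1..m}) \<subseteq> pos_int_adjoin ((\<lambda>i. r i powr s) ` {1..n})"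
proof -
  obtain f L where fL: "1 \<le> L" "bij_betw f E F"
    "\<And>x y. x \<in> E \<Longrightarrow> y \<in> E \<Longrightarrow> inverse L * dist x y \<le> dist (f x) (f y)"
    "\<And>x y. x \<in> E \<Longrightarrow> y \<in> E \<Longrightarrow> dist (f x) (f y) \<le> L * dist x y"
    using assms(3) unfolding lipschitz_equivalent_def by blast
  interpret lipschitz_pair n S r E s m T t F f L
    by (intro lipschitz_pair.intro lipschitz_pair_axioms.intro assms fL)
  show ?thesis using ratio_power_in_adjoin by (intro pos_int_adjoin_subset) auto
qed

theorem theorem2p2:
  fixes S :: "nat \<Rightarrow> 'a::euclidean_space \<Rightarrow> 'a" and T :: "nat \<Rightarrow> 'b::euclidean_space \<Rightarrow> 'b"
    and r t :: "nat \<Rightarrow> real" and n m :: nat and E\<^sub>S :: "'a set" and E\<^sub>T :: "'b set" and s :: real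
  assumes "is_ifs n S r" and "is_attractor n S E\<^sub>S" and "strong_separation n S E\<^sub>S"
    and "is_ifs m T t" and "is_attractor m T E\<^sub>T" and "strong_separation m T E\<^sub>T"
    and "lipschitz_equivalent E\<^sub>S E\<^sub>T"
    and "hausdorff_dim E\<^sub>S = ereal s" and "hausdorff_dim E\<^sub>T = ereal s"
  shows "pos_int_adjoin ((\<lambda>i. r i powr s) ` {1..n}) = pos_int_adjoin ((\<lambda>j. t j powr s) ` {1..m})"
proof -
  have S: "ssc_dim n S r E\<^sub>S s"
    using assms by (intro ssc_ifs.moran_of_hausdorff_dim ssc_ifs.intro)
  have T: "ssc_dim m T t E\<^sub>T s"
    using assms by (intro ssc_ifs.moran_of_hausdorff_dim ssc_ifs.intro)
  show ?thesis
    using adjoin_subset_of_lipschitz_equivalent[OF S T] adjoin_subset_of_lipschitz_equivalent[OF T S]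
      lipschitz_equivalent_sym assms(7) by blast
qed

end
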